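(* Let $X\subset\mathbb{P}^4$ (homogeneous coordinates $(x:y:z:w:t)$, over $\mathbb{C}$) be the $S_5$-invariant quintic threefold with equation $$7m_{(5,0,0,0,0)}-5m_{(4,1,0,0,0)}-2m_{(3,2,0,0,0)}+4m_{(3,1,1,0,0)}+2m_{(2,2,1,0,0)}-4m_{(2,1,1,1,0)}+8m_{(1,1,1,1,1)}=0,$$ where $m_{\alpha}=m_\alpha(x,y,z,w,t)$ denotes the monomial symmetric polynomial. Let $I_4\subset\mathbb{P}^4$ be the Igusa quartic, i.e. the dual of the Segre cubic. Then $X$ intersects the Igusa quartic $I_4$ along its singular lines, and has cusps along each of these lines.
   Context: All varieties are over $\mathbb{C}$. For $\alpha=(\alpha_1,\dots,\alpha_5)$, $m_{\alpha}(x,y,z,w,t)$ is the sum of all distinct monomials $x^{\beta_1}y^{\beta_2}z^{\beta_3}w^{\beta_4}t^{\beta_5}$ with $(\beta_1,\dots,\beta_5)$ a permutation of $\alpha$. The Segre cubic is the hypersurface $\{f=0\}\subset\mathbb{P}^4$ with $f=x^3+y^3+z^3+w^3+t^3+h^3$, $h:=-x-y-z-w-t$. The Igusa quartic $I_4$ is the dual of the Segre cubic, taken in coordinates as the closure of the image of $\{f=0\}$ under the map to $\mathbb{P}^4$ given by the partial derivatives $\left(\frac{\partial f}{\partial x}:\frac{\partial f}{\partial y}:\frac{\partial f}{\partial z}:\frac{\partial f}{\partial w}:\frac{\partial f}{\partial t}\right)$, with homogeneous coordinates on the target again denoted $(x:y:z:w:t)$. The singular set of $I_4$ is a union of $15$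 lines; these are its singular lines. A cusp of a surface is a singularity of type $\mathsf{A}_2$. That $X$ has cusps along these lines (the lines are "cuspidal lines" of $X$) means that a general hyperplane section of $X$ is a quintic surface with $15$ cusps, at the points where the hyperplane meets the $15$ lines.
   Formalization: "X intersects I_4 along its singular lines" is stated as: the singular lines lie in X ∩ I_4. Equality is impossible, since two hypersurfaces in P^4 meet in dimension at least 2, so X ∩ I_4 cannot be a union of lines. *)

theory Defs
  imports "HOL-Analysis.Analysis" "HOL-Combinatorics.Multiset_Permutations"
begin

text \<open>
  Subsets of \<open>\<P>\<^sup>4\<close> are represented by their affine cones in \<open>complex^5\<close>, with
  \<open>(x, y, z, w, t) = (v $ 1, v $ 2, v $ 3, v $ 4, v $ 5)\<close>. Points, lines and hyperplanes of
  \<open>\<P>\<^sup>4\<close> are the complex linear subspaces of dimension 1, 2 and 4.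
\<close>


subsection \<open>Forms and Zariski closure\<close>

text \<open>As the field is infinite, polynomials are identified with polynomial functions.\<close>

inductive polynomial_fun :: "(complex ^ 'n \<Rightarrow> complex) \<Rightarrow> bool" where
  const: "polynomial_fun (\<lambda>v. c)"
| coord: "polynomial_fun (\<lambda>v. v $ i)"
| add: "polynomial_fun f \<Longrightarrow> polynomial_fun g \<Longrightarrow> polynomial_fun (\<lambda>v. f v + g v)"
| mult: "polynomial_fun f \<Longrightarrow> polynomial_fun g \<Longrightarrow> polynomial_fun (\<lambda>v. f v * g v)"

definition form :: "nat \<Rightarrow> (complex ^ 'n \<Rightarrow> complex) \<Rightarrow> bool" where
  "form d g \<longleftrightarrow> polynomial_fun g \<and> (\<forall>c v. g (c *s v) = c ^ d * g v)"

definition vanishing_forms :: "(complex ^ 'n) set \<Rightarrow> (complex ^ 'n \<Rightarrow> complex) set" where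
  "vanishing_forms S = {g. (\<exists>d. form d g) \<and> (\<forall>v\<in>S. g v = 0)}"

definition zariski_closure :: "(complex ^ 'n) set \<Rightarrow> (complex ^ 'n) set" where
  "zariski_closure S = {v. \<forall>g\<in>vanishing_forms S. g v = 0}"

text \<open>\<open>P\<close> holds on a nonempty Zariski open subset of the projective space.\<close>

definition holds_generally :: "(complex ^ 'n \<Rightarrow> bool) \<Rightarrow> bool" where
  "holds_generally P \<longleftrightarrow>
     (\<exists>d G. form d G \<and> (\<exists>a. G a \<noteq> 0) \<and> (\<forall>a. a \<noteq> 0 \<longrightarrow> G a \<noteq> 0 \<longrightarrow> P a))"


subsection \<open>Tangent spaces and singular lines\<close>

definition partial :: "'n \<Rightarrow> (complex ^ 'n \<Rightarrow> complex) \<Rightarrow> complex ^ 'n \<Rightarrow> complex" where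
  "partial i g v = deriv (\<lambda>s. g (v + axis i s)) 0"

definition tangent_space :: "(complex ^ 'n) set \<Rightarrow> complex ^ 'n \<Rightarrow> (complex ^ 'n) set" where
  "tangent_space V v =
     {u. \<forall>g\<in>vanishing_forms V. (\<Sum>i\<in>UNIV. partial i g v * u $ i) = 0}"

text \<open>
  For the cone \<open>V\<close> over a projective variety of pure dimension \<open>n\<close>: the tangent space of the
  cone is the one of the variety enlarged by the radial direction, whence the \<open>n + 1\<close>.
\<close>

definition singular_points :: "nat \<Rightarrow> (complex ^ 'n) set \<Rightarrow> (complex ^ 'n) set" where
  "singular_points n V = {v \<in> V. v \<noteq> 0 \<and> vec.dim (tangent_space V v) > n + 1}"

definition singular_lines :: "nat \<Rightarrow> (complex ^ 'n) set \<Rightarrow> (complex ^ 'n) set set" where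
  "singular_lines n V =
     {L. vec.subspace L \<and> vec.dim L = 2 \<and> L - {0} \<subseteq> singular_points n V}"


subsection \<open>Cusps of hyperplane sections\<close>

definition holomorphic_fun :: "(complex ^ 'm) set \<Rightarrow> (complex ^ 'm \<Rightarrow> complex) \<Rightarrow> bool" where
  "holomorphic_fun U f \<longleftrightarrow>
     (\<forall>z\<in>U. \<exists>D. (f has_derivative D) (at z) \<and> (\<forall>c u. D (c *s u) = c * D u))"

definition holomorphic_map :: "(complex ^ 'm) set \<Rightarrow> (complex ^ 'm \<Rightarrow> complex ^ 'n) \<Rightarrow> bool" where
  "holomorphic_map U \<phi> \<longleftrightarrow> (\<forall>i. holomorphic_fun U (\<lambda>z. \<phi> z $ i))"

text \<open>
  The germ at the origin of the surface \<open>f = 0\<close> is of type \<open>A\<^sub>2\<close>: after a biholomorphic change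
  of coordinates, \<open>f\<close> is a unit times \<open>x\<^sup>2 + y\<^sup>2 + z\<^sup>3\<close>.
\<close>

definition A2_singularity :: "(complex ^ 3 \<Rightarrow> complex) \<Rightarrow> bool" where
  "A2_singularity f \<longleftrightarrow>
     (\<exists>U V e. \<exists>(\<phi> :: complex ^ 3 \<Rightarrow> complex ^ 3) \<psi>. open U \<and> open V \<and> 0 \<in> U \<and> 0 \<in> V \<and> \<phi> 0 = 0 \<and>
        homeomorphism U V \<phi> \<psi> \<and> holomorphic_map U \<phi> \<and> holomorphic_map V \<psi> \<and>
        holomorphic_fun U e \<and>
        (\<forall>z\<in>U. e z \<noteq> 0 \<and> f (\<phi> z) = e z * ((z $ 1)\<^sup>2 + (z $ 2)\<^sup>2 + (z $ 3) ^ 3)))"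

definition hyperplane :: "complex ^ 'n \<Rightarrow> (complex ^ 'n) set" where
  "hyperplane a = {v. (\<Sum>i\<in>UNIV. a $ i * v $ i) = 0}"

text \<open>
  The cusps of the surface cut out by the form \<open>F\<close> in the hyperplane \<open>H\<close>. For a basis
  \<open>v, b 1, b 2, b 3\<close> of \<open>H\<close>, the point \<open>v + \<Sum>i. z $ i *s b i\<close> has affine coordinates \<open>z\<close>
  in a chart of \<open>\<P>(H)\<close> centred at the point spanned by \<open>v\<close>.
\<close>

definition section_cusps ::
    "(complex ^ 5 \<Rightarrow> complex) \<Rightarrow> (complex ^ 5) set \<Rightarrow> (complex ^ 5) set set" where
  "section_cusps F H =
     {vec.span {v} | v b. vec.dim H = 4 \<and> H = vec.span (insert v (range (b :: 3 \<Rightarrow> complex ^ 5))) \<and>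
        A2_singularity (\<lambda>z. F (v + (\<Sum>i\<in>UNIV. z $ i *s b i)))}"


subsection \<open>The Igusa quartic and the quintic\<close>

definition segre_cubic :: "complex ^ 5 \<Rightarrow> complex" where
  "segre_cubic v =
     (let h = - v $ 1 - v $ 2 - v $ 3 - v $ 4 - v $ 5
      in (v $ 1) ^ 3 + (v $ 2) ^ 3 + (v $ 3) ^ 3 + (v $ 4) ^ 3 + (v $ 5) ^ 3 + h ^ 3)"

definition gradient :: "(complex ^ 'n \<Rightarrow> complex) \<Rightarrow> complex ^ 'n \<Rightarrow> complex ^ 'n" where
  "gradient g v = (\<chi> i. partial i g v)"

text \<open>The gradient map is not defined at the nodes of the Segre cubic, where the gradient is 0.\<close>

definition igusa_quartic :: "(complex ^ 5) set" where
  "igusa_quartic =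
     zariski_closure {gradient segre_cubic v | v. segre_cubic v = 0 \<and> gradient segre_cubic v \<noteq> 0}"

definition monomial_symmetric :: "nat list \<Rightarrow> complex ^ 5 \<Rightarrow> complex" where
  "monomial_symmetric \<alpha> v =
     (\<Sum>\<beta>\<in>permutations_of_multiset (mset \<alpha>).
        (v $ 1) ^ (\<beta> ! 0) * (v $ 2) ^ (\<beta> ! 1) * (v $ 3) ^ (\<beta> ! 2) * (v $ 4) ^ (\<beta> ! 3) * (v $ 5) ^ (\<beta> ! 4))"

definition quintic :: "complex ^ 5 \<Rightarrow> complex" where
  "quintic v =
     7 * monomial_symmetric [5,0,0,0,0] v - 5 * monomial_symmetric [4,1,0,0,0] v
     - 2 * monomial_symmetric [3,2,0,0,0] v + 4 * monomial_symmetric [3,1,1,0,0] v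
     + 2 * monomial_symmetric [2,2,1,0,0] v - 4 * monomial_symmetric [2,1,1,1,0] v
     + 8 * monomial_symmetric [1,1,1,1,1] v"

definition quintic_threefold :: "(complex ^ 5) set" where
  "quintic_threefold = {v. quintic v = 0}"

end

theory Submission
  imports Defs "HOL-Library.Function_Algebras"
begin

text \<open>
  Write \<open>p\<^sub>k\<close> for the power sums. The partial derivatives of the Igusa quartic \<open>Q\<close> are \<open>4 c(x\<^sub>i)\<close> for
  one cubic \<open>c\<close> with coefficients in the \<open>p\<^sub>k\<close>, and those of the quintic are \<open>(8 x\<^sub>i c(x\<^sub>i) - Q) / 3\<close>.
  Hence a critical point of either form has at most three, respectively four, distinct coordinates,
  and going through the possible coincidences leaves only the 15 lines
  \<open>x\<^sub>a = x\<^sub>b, x\<^sub>c = x\<^sub>d, x\<^sub>e = 0\<close>. Along these lines the tangent space of \<open>I\<^sub>4\<close> is everything, because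
  the gradient map of the Segre cubic sends enough curves on the cubic through a given point.

  At the point \<open>(s + p, s - p, u + q, u - q, t)\<close> near such a line the quintic has the shape
  \<open>p\<^sup>2 D + q\<^sup>2 E + t\<^sup>3 A\<close> with \<open>D, E, A \<noteq> 0\<close> at general points of the line, so taking roots of \<open>D, E, A\<close>
  gives the coordinate change to \<open>x\<^sup>2 + y\<^sup>2 + z\<^sup>3\<close>.

  A further cusp of a hyperplane section would be a smooth point of \<open>X\<close> at which the hyperplane is
  tangent. General hyperplanes are not tangent anywhere: the forms of degree \<open>n\<close> in the five
  partial derivatives outnumber, for large \<open>n\<close>, the forms of degree \<open>4 n\<close> modulo the quintic, so that
  some nonzero form vanishes on the dual variety.
\<close>

section \<open>Forms and power sums\<close>

lemma UNIV_5_distinct: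
  fixes a b c d e :: 5
  assumes "distinct [a, b, c, d, e]"
  shows "UNIV = {a, b, c, d, e}"
proof -
  have "card {a, b, c, d, e} = CARD(5)"
    using assms by simp
  then show ?thesis
    by (metis card_subset_eq finite_class.finite_UNIV subset_UNIV)
qed

lemma sum_UNIV_5_distinct:
  fixes a b c d e :: 5
  assumes "distinct [a, b, c, d, e]"
  shows "(\<Sum>i\<in>UNIV. f i) = f a + f b + f c + f d + f e"
  unfolding UNIV_5_distinct[OF assms] using assms by (simp add: add.assoc)

lemma UNIV_5: "(UNIV :: 5 set) = {1, 2, 3, 4, 5}"
  by (rule UNIV_5_distinct) simp

lemma sum_UNIV_5: "(\<Sum>i\<in>UNIV. f (i :: 5)) = f 1 + f 2 + f 3 + f 4 + f 5"
  by (rule sum_UNIV_5_distinct) simp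

section \<open>Polynomial functions and their derivatives\<close>

lemma polynomial_fun_sum:
  "(\<And>i. i \<in> I \<Longrightarrow> polynomial_fun (f i)) \<Longrightarrow> polynomial_fun (\<lambda>v. \<Sum>i\<in>I. f i v)"
  by (induction I rule: infinite_finite_induct)
    (auto intro: polynomial_fun.intros)

lemma polynomial_fun_power: "polynomial_fun f \<Longrightarrow> polynomial_fun (\<lambda>v. f v ^ n)"
  by (induction n) (auto intro: polynomial_fun.intros)

lemma polynomial_fun_uminus: "polynomial_fun f \<Longrightarrow> polynomial_fun (\<lambda>v. - f v)"
  using polynomial_fun.mult[OF polynomial_fun.const[of "-1"]] by simp

lemma polynomial_fun_diff:
  "polynomial_fun f \<Longrightarrow> polynomial_fun g \<Longrightarrow> polynomial_fun (\<lambda>v. f v - g v)"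
  using polynomial_fun.add[OF _ polynomial_fun_uminus] by fastforce

lemmas polynomial_fun_intros = polynomial_fun.intros polynomial_fun_sum
  polynomial_fun_power polynomial_fun_uminus polynomial_fun_diff

text \<open>\<open>partial\<close> differentiates along a coordinate axis, so by the chain rule it
  reads off one coefficient of the total derivative. The gradients of all three special forms are
  computed in this way.\<close>

lemma partial_eqI:
  assumes "(g has_derivative (\<lambda>u. \<Sum>i\<in>UNIV. D i * u $ i)) (at v)"
  shows "partial i g v = D i"
proof -
  have "linear (axis i :: complex \<Rightarrow> complex ^ 'a)"
    by (simp add: linear_iff vec_eq_iff axis_def)
  then have "bounded_linear (axis i :: complex \<Rightarrow> complex ^ 'a)"
    by (simp add: linear_conv_bounded_linear)
  then have "((\<lambda>s. v + axis i s) has_derivative axis i) (at 0)"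
    using has_derivative_add[OF has_derivative_const bounded_linear_imp_has_derivative] by fastforce
  moreover have "(g has_derivative (\<lambda>u. \<Sum>i\<in>UNIV. D i * u $ i)) (at (v + axis i 0))"
    using assms by (simp add: axis_def vec_eq_iff zero_vec_def[symmetric])
  ultimately have "((\<lambda>s. g (v + axis i s)) has_derivative (\<lambda>s. \<Sum>j\<in>UNIV. D j * axis i s $ j)) (at 0)"
    by (rule has_derivative_compose)
  moreover have "(\<lambda>s. \<Sum>j\<in>UNIV. D j * axis i s $ j) = (\<lambda>s. D i * s)"
    by (auto simp: axis_def if_distrib cong: if_cong)
  ultimately show ?thesis
    unfolding partial_def by (auto intro!: DERIV_imp_deriv simp: has_field_derivative_def)
qed

text \<open>The coefficients of the derivative are carried through the induction as polynomials,
  which later makes the partial derivatives polynomial and continuous.\<close>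

lemma polynomial_fun_derivative:
  fixes g :: "complex ^ 'n \<Rightarrow> complex"
  assumes "polynomial_fun g"
  shows "\<exists>D. (\<forall>i. polynomial_fun (D i)) \<and>
    (\<forall>v. (g has_derivative (\<lambda>u. \<Sum>i\<in>UNIV. D i v * u $ i)) (at v))"
  using assms
proof induction
  case (const c)
  show ?case
    by (intro exI[of _ "\<lambda>i v. 0"]) (auto intro: polynomial_fun_intros)
next
  case (coord i)
  have "(\<lambda>u. \<Sum>j\<in>UNIV. (if i = j then 1 else 0) * u $ j) = (\<lambda>u :: complex ^ 'n. u $ i)"
    by (simp add: if_distrib[of "\<lambda>x. x * _"] cong: if_cong)
  then have "((\<lambda>v. v $ i) has_derivative (\<lambda>u. \<Sum>j\<in>UNIV. (if i = j then 1 else 0) * u $ j)) (at v)"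
    for v :: "complex ^ 'n"
    by (simp add: bounded_linear_imp_has_derivative bounded_linear_vec_nth)
  then show ?case
    by (intro exI[of _ "\<lambda>j v. if i = j then 1 else 0"]) (simp add: polynomial_fun.const)
next
  case (add f g)
  then obtain D E where "\<And>i. polynomial_fun (D i)" "\<And>i. polynomial_fun (E i)"
    and D: "\<And>v. (f has_derivative (\<lambda>u. \<Sum>i\<in>UNIV. D i v * u $ i)) (at v)"
    and E: "\<And>v. (g has_derivative (\<lambda>u. \<Sum>i\<in>UNIV. E i v * u $ i)) (at v)"
    by blast
  then show ?case
    using has_derivative_add[OF D E]
    by (intro exI[of _ "\<lambda>i v. D i v + E i v"])
      (simp add: polynomial_fun.add sum.distrib distrib_right)
next
  case (mult f g)
  then obtain D E where "\<And>i. polynomial_fun (D i)" "\<And>i. polynomial_fun (E i)"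
    and D: "\<And>v. (f has_derivative (\<lambda>u. \<Sum>i\<in>UNIV. D i v * u $ i)) (at v)"
    and E: "\<And>v. (g has_derivative (\<lambda>u. \<Sum>i\<in>UNIV. E i v * u $ i)) (at v)"
    by blast
  with mult.hyps show ?case
    using has_derivative_mult[OF D E]
    by (intro exI[of _ "\<lambda>i v. f v * E i v + D i v * g v"])
      (simp add: polynomial_fun.add polynomial_fun.mult sum.distrib sum_distrib_left
        sum_distrib_right algebra_simps)
qed

lemma polynomial_fun_has_derivative:
  assumes "polynomial_fun g"
  shows "(g has_derivative (\<lambda>u. \<Sum>i\<in>UNIV. partial i g v * u $ i)) (at v)"
proof -
  obtain D where D: "(g has_derivative (\<lambda>u. \<Sum>i\<in>UNIV. D i v * u $ i)) (at v)"
    using polynomial_fun_derivative[OF assms] by blast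
  with partial_eqI[OF D] show ?thesis
    by simp
qed

lemma polynomial_fun_partial: "polynomial_fun g \<Longrightarrow> polynomial_fun (partial i g)"
proof -
  assume "polynomial_fun g"
  then obtain D where D: "\<forall>i. polynomial_fun (D i)"
    "\<forall>v. (g has_derivative (\<lambda>u. \<Sum>i\<in>UNIV. D i v * u $ i)) (at v)"
    using polynomial_fun_derivative by blast
  then have "partial i g = D i"
    by (intro ext partial_eqI) simp
  with D show ?thesis
    by simp
qed

lemma polynomial_fun_continuous: "polynomial_fun g \<Longrightarrow> continuous_on S g"
  by (intro continuous_at_imp_continuous_on ballI has_derivative_continuous)
    (rule polynomial_fun_has_derivative)

section \<open>Closure properties of forms\<close>

lemma form_const: "form 0 (\<lambda>v. c)"
  by (auto simp: form_def intro: polynomial_fun_intros)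

lemma form_coord: "form 1 (\<lambda>v. v $ i)"
  by (auto simp: form_def intro: polynomial_fun_intros)

lemma form_mult: "form d f \<Longrightarrow> form e g \<Longrightarrow> form (d + e) (\<lambda>v. f v * g v)"
  by (auto simp: form_def power_add intro: polynomial_fun_intros)

lemma form_cmult: "form d f \<Longrightarrow> form d (\<lambda>v. c * f v)"
  by (auto simp: form_def intro: polynomial_fun_intros)

lemma form_power: "form d f \<Longrightarrow> form (d * n) (\<lambda>v. f v ^ n)"
  by (auto simp: form_def power_mult power_mult_distrib intro: polynomial_fun_intros)

lemma form_add: "form d f \<Longrightarrow> form d g \<Longrightarrow> form d (\<lambda>v. f v + g v)"
  by (auto simp: form_def distrib_left intro: polynomial_fun_intros)

lemma form_diff: "form d f \<Longrightarrow> form d g \<Longrightarrow> form d (\<lambda>v. f v - g v)"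
  by (auto simp: form_def right_diff_distrib intro: polynomial_fun_intros)

lemma form_sum: "(\<And>i. i \<in> I \<Longrightarrow> form d (f i)) \<Longrightarrow> form d (\<lambda>v. \<Sum>i\<in>I. f i v)"
  by (auto simp: form_def sum_distrib_left intro!: polynomial_fun_intros sum.cong)

lemma form_prod: "(\<And>i. i \<in> I \<Longrightarrow> form (d i) (f i)) \<Longrightarrow> form (\<Sum>i\<in>I. d i) (\<lambda>v. \<Prod>i\<in>I. f i v)"
  by (induction I rule: infinite_finite_induct) (auto intro: form_const form_mult)

section \<open>Power sums, and the quartic and the quintic written in them\<close>

definition power_sum :: "nat \<Rightarrow> complex ^ 'n \<Rightarrow> complex" where
  "power_sum k v = (\<Sum>i\<in>UNIV. (v $ i) ^ k)"

lemma form_power_sum: "form k (power_sum k)"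
  unfolding power_sum_def using form_power[OF form_coord] by (intro form_sum) auto

lemma has_derivative_power_sum:
  "(power_sum k has_derivative (\<lambda>u. \<Sum>i\<in>UNIV. of_nat k * (v $ i) ^ (k - 1) * u $ i)) (at v)"
  unfolding power_sum_def
proof (rule has_derivative_sum)
  fix i
  show "((\<lambda>v. v $ i ^ k) has_derivative (\<lambda>u. of_nat k * (v $ i) ^ (k - 1) * u $ i)) (at v)"
    using has_derivative_power[OF bounded_linear_imp_has_derivative[OF bounded_linear_vec_nth[of i]], of k v UNIV]
    by (simp add: mult_ac)
qed

text \<open>Splits the permutations by their first entry. Repeated use lets simp expand a monomial
  symmetric polynomial into explicit monomials.\<close>

lemma sum_permutations_of_multiset:
  assumes "A \<noteq> {#}"
  shows "(\<Sum>\<beta>\<in>permutations_of_multiset A. f \<beta>) =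
    (\<Sum>x\<in>set_mset A. \<Sum>\<beta>\<in>permutations_of_multiset (A - {#x#}). f (x # \<beta>))"
proof -
  have "(\<Sum>\<beta>\<in>permutations_of_multiset A. f \<beta>) =
    (\<Sum>x\<in>set_mset A. \<Sum>\<beta>\<in>(#) x ` permutations_of_multiset (A - {#x#}). f \<beta>)"
    unfolding permutations_of_multiset_nonempty[OF assms] by (rule sum.UNION_disjoint) auto
  then show ?thesis
    by (simp add: sum.reindex)
qed

text \<open>Change of basis from monomial symmetric polynomials to power sums. The seven conversions
  have the denominators 1, 1, 1, 2, 2, 6, 120; once they are multiplied by the coefficients of the
  quintic, the factor 15 clears what is left.\<close>

lemma quintic_power_sums:
  "15 * quintic v = 384 * power_sum 5 v - 240 * power_sum 4 v * power_sum 1 v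
    - 160 * power_sum 3 v * power_sum 2 v + 80 * power_sum 3 v * (power_sum 1 v)\<^sup>2
    + 60 * (power_sum 2 v)\<^sup>2 * power_sum 1 v - 20 * power_sum 2 v * (power_sum 1 v) ^ 3
    + (power_sum 1 v) ^ 5"
proof -
  define p where "p k = power_sum k v" for k
  have m1: "monomial_symmetric [5, 0, 0, 0, 0] v =
    p 5"
    by (simp add: monomial_symmetric_def sum_permutations_of_multiset del: One_nat_def;
        simp only: p_def power_sum_def sum_UNIV_5 power_one_right One_nat_def[symmetric]; algebra)
  have m2: "monomial_symmetric [4, 1, 0, 0, 0] v =
    - p 5 + p 4 * p 1"
    by (simp add: monomial_symmetric_def sum_permutations_of_multiset del: One_nat_def;
        simp only: p_def power_sum_def sum_UNIV_5 power_one_right One_nat_def[symmetric]; algebra)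
  have m3: "monomial_symmetric [3, 2, 0, 0, 0] v =
    - p 5 + p 3 * p 2"
    by (simp add: monomial_symmetric_def sum_permutations_of_multiset del: One_nat_def;
        simp only: p_def power_sum_def sum_UNIV_5 power_one_right One_nat_def[symmetric]; algebra)
  have m4: "2 * monomial_symmetric [3, 1, 1, 0, 0] v =
    2 * p 5 - 2 * p 4 * p 1 - p 3 * p 2 + p 3 * (p 1)\<^sup>2"
    by (simp add: monomial_symmetric_def sum_permutations_of_multiset del: One_nat_def;
        simp only: p_def power_sum_def sum_UNIV_5 power_one_right One_nat_def[symmetric]; algebra)
  have m5: "2 * monomial_symmetric [2, 2, 1, 0, 0] v =
    2 * p 5 - p 4 * p 1 - 2 * p 3 * p 2 + (p 2)\<^sup>2 * p 1"
    by (simp add: monomial_symmetric_def sum_permutations_of_multiset del: One_nat_def;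
        simp only: p_def power_sum_def sum_UNIV_5 power_one_right One_nat_def[symmetric]; algebra)
  have m6: "6 * monomial_symmetric [2, 1, 1, 1, 0] v =
    - 6 * p 5 + 6 * p 4 * p 1 + 5 * p 3 * p 2 - 3 * p 3 * (p 1)\<^sup>2 - 3 * (p 2)\<^sup>2 * p 1 + p 2 * (p 1) ^ 3"
    by (simp add: monomial_symmetric_def sum_permutations_of_multiset del: One_nat_def;
        simp only: p_def power_sum_def sum_UNIV_5 power_one_right One_nat_def[symmetric]; algebra)
  have m7: "120 * monomial_symmetric [1, 1, 1, 1, 1] v =
    24 * p 5 - 30 * p 4 * p 1 - 20 * p 3 * p 2 + 20 * p 3 * (p 1)\<^sup>2 + 15 * (p 2)\<^sup>2 * p 1 - 10 * p 2 * (p 1) ^ 3 + (p 1) ^ 5"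
    by (simp add: monomial_symmetric_def sum_permutations_of_multiset del: One_nat_def;
        simp only: p_def power_sum_def sum_UNIV_5 power_one_right One_nat_def[symmetric]; algebra)
  have "15 * quintic v = 105 * monomial_symmetric [5, 0, 0, 0, 0] v
    - 75 * monomial_symmetric [4, 1, 0, 0, 0] v - 30 * monomial_symmetric [3, 2, 0, 0, 0] v
    + 30 * (2 * monomial_symmetric [3, 1, 1, 0, 0] v) + 15 * (2 * monomial_symmetric [2, 2, 1, 0, 0] v)
    - 10 * (6 * monomial_symmetric [2, 1, 1, 1, 0] v) + 120 * monomial_symmetric [1, 1, 1, 1, 1] v"
    unfolding quintic_def by algebra
  then show ?thesis
    unfolding m1 m2 m3 m4 m5 m6 m7 p_def[symmetric] by algebra
qed

text \<open>An equation of the Igusa quartic; it is shown below to vanish on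
  \<open>igusa_quartic\<close>.\<close>

definition igusa_form :: "complex ^ 5 \<Rightarrow> complex" where
  "igusa_form v = 48 * power_sum 4 v - 32 * power_sum 3 v * power_sum 1 v
    - 12 * (power_sum 2 v)\<^sup>2 + 12 * power_sum 2 v * (power_sum 1 v)\<^sup>2 - (power_sum 1 v) ^ 4"

text \<open>The cubic \<open>c\<close> of the overview. \<open>T\<close> is an independent variable,
  so that the five partial derivatives become values of one polynomial in one variable, with
  coefficients symmetric in \<open>v\<close>.\<close>

definition critical_cubic :: "complex ^ 5 \<Rightarrow> complex \<Rightarrow> complex" where
  "critical_cubic v T = 48 * T ^ 3 - 24 * power_sum 1 v * T\<^sup>2
    + (6 * (power_sum 1 v)\<^sup>2 - 12 * power_sum 2 v) * T
    + (6 * power_sum 1 v * power_sum 2 v - 8 * power_sum 3 v - (power_sum 1 v) ^ 3)"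

lemma form_igusa_form: "form 4 igusa_form"
proof -
  have "form 4 (\<lambda>v. power_sum 3 v * power_sum 1 v)"
    using form_mult[OF form_power_sum[of 3] form_power_sum[of 1]] by simp
  moreover have "form 4 (\<lambda>v. (power_sum 2 v)\<^sup>2)" "form 4 (\<lambda>v. (power_sum 1 v) ^ 4)"
    using form_power[OF form_power_sum[of 2], of 2] form_power[OF form_power_sum[of 1], of 4] by simp_all
  moreover have "form 4 (\<lambda>v. power_sum 2 v * (power_sum 1 v)\<^sup>2)"
    using form_mult[OF form_power_sum[of 2] form_power[OF form_power_sum[of 1], of 2]] by simp
  ultimately show ?thesis
    unfolding igusa_form_def[abs_def] mult.assoc
    by (intro form_add form_diff form_cmult form_power_sum)
qed

lemma partial_igusa_form: "partial i igusa_form v = 4 * critical_cubic v (v $ i)"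
proof (rule partial_eqI)
  note [derivative_intros] = has_derivative_power_sum
  show "(igusa_form has_derivative (\<lambda>u. \<Sum>i\<in>UNIV. 4 * critical_cubic v (v $ i) * u $ i)) (at v)"
    unfolding igusa_form_def[abs_def] critical_cubic_def
    by (rule has_derivative_eq_rhs, (rule derivative_intros)+)
      (simp add: fun_eq_iff sum_UNIV_5, algebra)
qed

lemma has_derivative_quintic:
  "(quintic has_derivative
    (\<lambda>u. \<Sum>i\<in>UNIV. (8 * v $ i * critical_cubic v (v $ i) - igusa_form v) / 3 * u $ i)) (at v)"
proof -
  note [derivative_intros] = has_derivative_power_sum
  have q: "quintic = (\<lambda>v. 1 / 15 * (384 * power_sum 5 v - 240 * power_sum 4 v * power_sum 1 v
    - 160 * power_sum 3 v * power_sum 2 v + 80 * power_sum 3 v * (power_sum 1 v)\<^sup>2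
    + 60 * (power_sum 2 v)\<^sup>2 * power_sum 1 v - 20 * power_sum 2 v * (power_sum 1 v) ^ 3
    + (power_sum 1 v) ^ 5))"
    unfolding quintic_power_sums[symmetric] by simp
  show ?thesis
    unfolding q igusa_form_def critical_cubic_def
    by (rule has_derivative_eq_rhs, (rule derivative_intros)+)
      (simp add: fun_eq_iff sum_UNIV_5, rule allI, algebra)
qed

lemma partial_quintic:
  "partial i quintic v = (8 * v $ i * critical_cubic v (v $ i) - igusa_form v) / 3"
  by (rule partial_eqI) (rule has_derivative_quintic)

section \<open>Critical points of the quartic and the quintic\<close>

text \<open>Each line belongs to a splitting of the six coordinates of the Segre cubic (the sixth is
  \<open>h\<close>) into three pairs: \<open>{a, b}\<close>, \<open>{c, d}\<close>, and
  \<open>e\<close> with the sixth. There are 15 such splittings.\<close>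

definition pairing_line :: "5 \<Rightarrow> 5 \<Rightarrow> 5 \<Rightarrow> 5 \<Rightarrow> 5 \<Rightarrow> (complex ^ 5) set" where
  "pairing_line a b c d e = {v. v $ a = v $ b \<and> v $ c = v $ d \<and> v $ e = 0}"

definition pairing_lines :: "(complex ^ 5) set set" where
  "pairing_lines = {pairing_line a b c d e | a b c d e. distinct [a, b, c, d, e]}"

text \<open>Allowing \<open>k4 = 0\<close> lets the same divided differences serve the cubic that
  belongs to the Igusa quartic and the quartic that belongs to the quintic.\<close>

definition quartic :: "'a \<Rightarrow> 'a \<Rightarrow> 'a \<Rightarrow> 'a \<Rightarrow> 'a \<Rightarrow> 'a \<Rightarrow> 'a :: idom" where
  "quartic k4 k3 k2 k1 k0 T = k4 * T ^ 4 + k3 * T ^ 3 + k2 * T\<^sup>2 + k1 * T + k0"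

text \<open>The divided differences of a polynomial at distinct roots vanish.\<close>

lemma quartic_two_roots:
  assumes "quartic k4 k3 k2 k1 k0 a = 0" "quartic k4 k3 k2 k1 k0 b = 0" "a \<noteq> b"
  shows "k4 * (a ^ 3 + a\<^sup>2 * b + a * b\<^sup>2 + b ^ 3) + k3 * (a\<^sup>2 + a * b + b\<^sup>2) + k2 * (a + b) + k1 = 0"
proof -
  have "(a - b) * (k4 * (a ^ 3 + a\<^sup>2 * b + a * b\<^sup>2 + b ^ 3) + k3 * (a\<^sup>2 + a * b + b\<^sup>2)
      + k2 * (a + b) + k1) = quartic k4 k3 k2 k1 k0 a - quartic k4 k3 k2 k1 k0 b"
    unfolding quartic_def by algebra
  with assms show ?thesis by simp
qed

lemma quartic_three_roots:
  assumes "quartic k4 k3 k2 k1 k0 a = 0" "quartic k4 k3 k2 k1 k0 b = 0" "quartic k4 k3 k2 k1 k0 c = 0" "distinct [a, b, c]"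
  shows "k4 * (a\<^sup>2 + b\<^sup>2 + c\<^sup>2 + a * b + a * c + b * c) + k3 * (a + b + c) + k2 = 0"
proof -
  have "a \<noteq> b" "a \<noteq> c"
    using assms by auto
  from quartic_two_roots[OF assms(1,2) this(1)] quartic_two_roots[OF assms(1,3) this(2)]
  have "(b - c) * (k4 * (a\<^sup>2 + b\<^sup>2 + c\<^sup>2 + a * b + a * c + b * c) + k3 * (a + b + c) + k2) = 0"
    by algebra
  with assms show ?thesis by simp
qed

lemma quartic_four_roots:
  assumes "quartic k4 k3 k2 k1 k0 a = 0" "quartic k4 k3 k2 k1 k0 b = 0" "quartic k4 k3 k2 k1 k0 c = 0" "quartic k4 k3 k2 k1 k0 d = 0" "distinct [a, b, c, d]"
  shows "k4 * (a + b + c + d) + k3 = 0"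
proof -
  have "distinct [a, b, c]" "distinct [a, b, d]"
    using assms by auto
  from quartic_three_roots[OF assms(1,2,3) this(1)] quartic_three_roots[OF assms(1,2,4) this(2)]
  have "(c - d) * (k4 * (a + b + c + d) + k3) = 0"
    by algebra
  with assms show ?thesis by simp
qed

lemma quartic_five_roots:
  assumes "quartic k4 k3 k2 k1 k0 a = 0" "quartic k4 k3 k2 k1 k0 b = 0" "quartic k4 k3 k2 k1 k0 c = 0" "quartic k4 k3 k2 k1 k0 d = 0" "quartic k4 k3 k2 k1 k0 e = 0" "distinct [a, b, c, d, e]"
  shows "k4 = 0"
proof -
  have "distinct [a, b, c, d]" "distinct [a, b, c, e]"
    using assms by auto
  from quartic_four_roots[OF assms(1,2,3,4) this(1)] quartic_four_roots[OF assms(1,2,3,5) this(2)]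
  have "(d - e) * k4 = 0"
    by algebra
  with assms show ?thesis by simp
qed

text \<open>The cases are the seven partitions of 5, in the order 1+1+1+1+1, 2+1+1+1, 3+1+1, 2+2+1,
  4+1, 3+2, 5; different blocks carry different values.\<close>

lemma equality_pattern_cases:
  fixes v :: "'a ^ 5"
  obtains a b c d e where "distinct [a, b, c, d, e]" "distinct [v $ a, v $ b, v $ c, v $ d, v $ e]"
  | a b c d e where "distinct [a, b, c, d, e]" "v $ b = v $ a" "distinct [v $ a, v $ c, v $ d, v $ e]"
  | a b c d e where "distinct [a, b, c, d, e]" "v $ b = v $ a" "v $ c = v $ a"
      "distinct [v $ a, v $ d, v $ e]"
  | a b c d e where "distinct [a, b, c, d, e]" "v $ b = v $ a" "v $ d = v $ c"
      "distinct [v $ a, v $ c, v $ e]"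
  | a b c d e where "distinct [a, b, c, d, e]" "v $ b = v $ a" "v $ c = v $ a" "v $ d = v $ a"
      "v $ a \<noteq> v $ e"
  | a b c d e where "distinct [a, b, c, d, e]" "v $ b = v $ a" "v $ c = v $ a" "v $ e = v $ d"
      "v $ a \<noteq> v $ d"
  | a b c d e where "distinct [a, b, c, d, e]" "v $ b = v $ a" "v $ c = v $ a" "v $ d = v $ a"
      "v $ e = v $ a"
proof -
  note pat = that
  have ex: "\<exists>e. distinct [a, b, c, d, e]" if "distinct [a, b, c, d]" for a b c d :: 5
  proof -
    have "card {a, b, c, d} < CARD(5)"
      using that by simp
    then have "\<exists>e. e \<notin> {a, b, c, d}"
      by (metis UNIV_eq_I less_irrefl)
    then show ?thesis using that by auto
  qed
  have ex3: "\<exists>d e. distinct [a, b, c, d, e]" if "distinct [a, b, c]" for a b c :: 5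
  proof -
    have "card {a, b, c} < CARD(5)"
      using that by simp
    then obtain d where "d \<notin> {a, b, c}"
      by (metis UNIV_eq_I less_irrefl)
    with that have "distinct [a, b, c, d]" by auto
    then show ?thesis using ex by blast
  qed
  have ex2: "\<exists>c d e. distinct [a, b, c, d, e]" if "distinct [a, b]" for a b :: 5
  proof -
    have "card {a, b} < CARD(5)"
      using that by simp
    then obtain c where "c \<notin> {a, b}"
      by (metis UNIV_eq_I less_irrefl)
    with that have "distinct [a, b, c]" by auto
    then show ?thesis using ex3 by blast
  qed
  show thesis
  proof (cases "inj (\<lambda>i. v $ i)")
    case True
    then show thesis
      by (intro pat(1)[of 1 2 3 4 5]) (auto dest: injD)
  next
    case False
    then obtain a b where "distinct [a, b]" and ab: "v $ b = v $ a"
      by (auto simp: inj_def)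
    then obtain c d e where dist: "distinct [a, b, c, d, e]"
      using ex2 by blast
    \<comment> \<open>Once three coordinates agree, only the other two are open: this gives 3+1+1,
      3+2, 4+1 and 5.\<close>
    have triple: thesis if "distinct [a, b, c, d, e]" "v $ b = v $ a" "v $ c = v $ a" for a b c d e
    proof -
      consider "distinct [v $ a, v $ d, v $ e]" | "v $ d = v $ a" "v $ e = v $ a"
        | "v $ d = v $ a" "v $ a \<noteq> v $ e" | "v $ e = v $ a" "v $ a \<noteq> v $ d"
        | "v $ e = v $ d" "v $ a \<noteq> v $ d"
        by (cases "v $ d = v $ a"; cases "v $ e = v $ a"; cases "v $ e = v $ d") auto
      then show thesis
        using that by cases (use pat(3)[of a b c d e] pat(7)[of a b c d e] pat(5)[of a b c d e]
          pat(5)[of a b c e d] pat(6)[of a b c d e] in auto)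
    qed
    consider "v $ a = v $ c \<or> v $ a = v $ d \<or> v $ a = v $ e"
      | "v $ d = v $ c" "v $ e = v $ c" | "distinct [v $ a, v $ c, v $ d, v $ e]"
      | "v $ d = v $ c" "distinct [v $ a, v $ c, v $ e]"
      | "v $ e = v $ c" "distinct [v $ a, v $ c, v $ d]"
      | "v $ e = v $ d" "distinct [v $ a, v $ d, v $ c]"
      by (cases "v $ d = v $ c"; cases "v $ e = v $ c"; cases "v $ e = v $ d") auto
    then show thesis
    proof cases
      case 1
      then show thesis
        using dist ab triple[of a b c d e] triple[of a b d c e] triple[of a b e c d] by auto
    next
      case 2
      then show thesis
        using dist ab triple[of c d e a b] by auto
    next
      case 3
      then show thesis
        using dist ab pat(2)[of a b c d e] by auto
    next
      case 4
      then show thesis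
        using dist ab pat(4)[of a b c d e] by auto
    next
      case 5
      then show thesis
        using dist ab pat(4)[of a b c e d] by auto
    next
      case 6
      then show thesis
        using dist ab pat(4)[of a b d e c] by auto
    qed
  qed
qed

section \<open>Critical points of both forms, by pattern of equal coordinates\<close>

lemma in_pairing_lineI:
  assumes "distinct [a, b, c, d, e]" "v $ a = v $ b" "v $ c = v $ d" "v $ e = 0"
  shows "v \<in> \<Union> pairing_lines"
  using assms unfolding pairing_lines_def pairing_line_def by blast

lemma power_sum_distinct:
  fixes a b c d e :: 5
  assumes "distinct [a, b, c, d, e]"
  shows "power_sum k v = (v $ a) ^ k + (v $ b) ^ k + (v $ c) ^ k + (v $ d) ^ k + (v $ e) ^ k"
  unfolding power_sum_def by (rule sum_UNIV_5_distinct[OF assms])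

text \<open>All coordinates are roots of one cubic with leading coefficient 48, so four distinct
  values are impossible. In the other patterns the power sums become explicit, and the divided
  differences give short equations between the distinct values.\<close>

lemma critical_igusa_form:
  assumes crit: "\<And>i. partial i igusa_form v = 0"
  shows "v \<in> \<Union> pairing_lines"
proof -
  define p where "p k = power_sum k v" for k
  have root: "quartic 0 48 (- 24 * p 1) (6 * (p 1)\<^sup>2 - 12 * p 2)
    (6 * p 1 * p 2 - 8 * p 3 - (p 1) ^ 3) (v $ i) = 0" for i
  proof -
    have "critical_cubic v (v $ i) = 0"
      using crit[of i] by (simp add: partial_igusa_form)
    then show ?thesis
      by (simp add: critical_cubic_def p_def quartic_def)
  qed
  note r2 = quartic_two_roots[OF root root]
  note r3 = quartic_three_roots[OF root root root]
  note r4 = quartic_four_roots[OF root root root root]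
  have P: "p 1 = v $ a + v $ b + v $ c + v $ d + v $ e"
      "p 2 = (v $ a)\<^sup>2 + (v $ b)\<^sup>2 + (v $ c)\<^sup>2 + (v $ d)\<^sup>2 + (v $ e)\<^sup>2"
      "p 3 = (v $ a) ^ 3 + (v $ b) ^ 3 + (v $ c) ^ 3 + (v $ d) ^ 3 + (v $ e) ^ 3"
    if "distinct [a, b, c, d, e]" for a b c d e
    using power_sum_distinct[OF that] by (simp_all add: p_def)
  show ?thesis
  proof (cases rule: equality_pattern_cases[of v])
    case (1 a b c d e)
    then show ?thesis using r4[of a b c d] by simp
  next
    case (2 a b c d e)
    then show ?thesis using r4[of a c d e] by simp
  next
    case (3 a b c d e)
    note p = P[OF 3(1), unfolded 3(2,3)]
    have ne: "v $ d \<noteq> v $ e" "v $ a \<noteq> v $ d" "v $ a \<noteq> v $ e"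
      using 3 by auto
    \<comment> \<open>Since the product of the last two values turns out to be 0, one of them is 0
      and the other equals \<open>v $ a\<close>: the pattern 3+1+1 does not occur.\<close>
    have sum: "v $ a = v $ d + v $ e"
      using r3[OF 3(4)] p by algebra
    then have "v $ d * v $ e = 0"
      using r2[OF ne(1)] p by algebra
    with sum ne show ?thesis by auto
  next
    case (4 a b c d e)
    have "v $ e = 0"
      using r3[OF 4(4)] P[OF 4(1), unfolded 4(2,3)] by algebra
    with 4 show ?thesis
      by (intro in_pairing_lineI[of a b c d e]) auto
  next
    case (5 a b c d e)
    note p = P[OF 5(1), unfolded 5(2,3,4)]
    \<comment> \<open>If the second factor vanished, the cubic at \<open>v $ a\<close> would give
      \<open>v $ a = 0\<close>, hence \<open>v $ e = 0\<close> as well, against the pattern.\<close>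
    have "v $ e * (3 * v $ e - 4 * v $ a) = 0"
      using r2[OF 5(5)] p by algebra
    moreover have "v $ a = 0" if "3 * v $ e = 4 * v $ a"
    proof -
      have "(v $ a) ^ 3 = 0"
        using that root[of a] p unfolding quartic_def by algebra
      then show ?thesis by simp
    qed
    ultimately have "v $ e = 0"
      using 5(5) by auto
    with 5 show ?thesis
      by (intro in_pairing_lineI[of a b c d e]) auto
  next
    case (6 a b c d e)
    have "(v $ a)\<^sup>2 = 0"
      using r2[OF 6(5)] P[OF 6(1), unfolded 6(2,3,4)] by algebra
    with 6 show ?thesis
      by (intro in_pairing_lineI[of d e a b c]) auto
  next
    case (7 a b c d e)
    have "(v $ a) ^ 3 = 0"
      using root[of a] P[OF 7(1), unfolded 7(2,3,4,5)] unfolding quartic_def by algebra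
    with 7 show ?thesis
      by (intro in_pairing_lineI[of a b c d e]) auto
  qed
qed

text \<open>The same argument for \<open>8 T c(T) - Q\<close>, whose leading coefficient 384
  excludes five distinct roots.\<close>

lemma critical_quintic:
  assumes crit: "\<And>i. partial i quintic v = 0"
  shows "v \<in> \<Union> pairing_lines"
proof -
  define p where "p k = power_sum k v" for k
  have root: "quartic 384 (- 192 * p 1) (48 * (p 1)\<^sup>2 - 96 * p 2)
    (48 * p 1 * p 2 - 64 * p 3 - 8 * (p 1) ^ 3)
    (- (48 * p 4 - 32 * p 3 * p 1 - 12 * (p 2)\<^sup>2 + 12 * p 2 * (p 1)\<^sup>2 - (p 1) ^ 4)) (v $ i) = 0" for i
    using crit[of i] unfolding quartic_def partial_quintic critical_cubic_def igusa_form_def p_def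
    by simp algebra
  note r2 = quartic_two_roots[OF root root]
  note r3 = quartic_three_roots[OF root root root]
  note r4 = quartic_four_roots[OF root root root root]
  note r5 = quartic_five_roots[OF root root root root root]
  have P: "p 1 = v $ a + v $ b + v $ c + v $ d + v $ e"
      "p 2 = (v $ a)\<^sup>2 + (v $ b)\<^sup>2 + (v $ c)\<^sup>2 + (v $ d)\<^sup>2 + (v $ e)\<^sup>2"
      "p 3 = (v $ a) ^ 3 + (v $ b) ^ 3 + (v $ c) ^ 3 + (v $ d) ^ 3 + (v $ e) ^ 3"
      "p 4 = (v $ a) ^ 4 + (v $ b) ^ 4 + (v $ c) ^ 4 + (v $ d) ^ 4 + (v $ e) ^ 4"
    if "distinct [a, b, c, d, e]" for a b c d e
    using power_sum_distinct[OF that] by (simp_all add: p_def)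
  show ?thesis
  proof (cases rule: equality_pattern_cases[of v])
    case (1 a b c d e)
    then show ?thesis using r5[of a b c d e] by simp
  next
    case (2 a b c d e)
    note p = P[OF 2(1), unfolded 2(2)]
    have ne: "v $ c \<noteq> v $ d" "v $ c \<noteq> v $ e" "v $ d \<noteq> v $ e" and dist: "distinct [v $ c, v $ d, v $ e]"
      using 2 by auto
    have sum: "v $ e = - v $ c - v $ d"
      using r4[OF 2(3)] p by algebra
    \<comment> \<open>Given the sum 0, this says that the second elementary symmetric function of
      \<open>v $ c\<close>, \<open>v $ d\<close>, \<open>v $ e\<close> vanishes. Their product is 0
      too, so all three values would be 0.\<close>
    have "(v $ c)\<^sup>2 + v $ c * v $ d + (v $ d)\<^sup>2 = 0"
      using r3[OF dist] p sum by algebra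
    moreover from this have "v $ c * v $ d * v $ e = 0"
      using r2[OF ne(1)] p sum by algebra
    moreover have "(v $ c)\<^sup>2 + v $ c * v $ e + (v $ e)\<^sup>2 = 0" "(v $ d)\<^sup>2 + v $ d * v $ e + (v $ e)\<^sup>2 = 0"
      using calculation(1) sum by algebra+
    ultimately show ?thesis
      using ne by auto
  next
    case (3 a b c d e)
    note p = P[OF 3(1), unfolded 3(2,3)]
    have ne: "v $ d \<noteq> v $ e" "v $ a \<noteq> v $ d" "v $ a \<noteq> v $ e"
      using 3 by auto
    \<comment> \<open>This expresses the product of \<open>v $ d\<close> and \<open>v $ e\<close> by
      their sum and \<open>v $ a\<close>, which leaves one factored equation between the latter two.
      Either factor forces two of the three values to agree.\<close>
    have prod: "4 * (v $ d * v $ e) = (3 * (v $ d + v $ e) + v $ a) * (v $ d + v $ e - v $ a)"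
      using r3[OF 3(4)] p by algebra
    then have "(v $ d + v $ e - v $ a)\<^sup>2 * (2 * (v $ d + v $ e) + v $ a) = 0"
      using r2[OF ne(1)] p by algebra
    then consider "v $ d + v $ e - v $ a = 0" | "2 * (v $ d + v $ e) + v $ a = 0"
      by fastforce
    then show ?thesis
    proof cases
      case 1
      with prod ne show ?thesis by auto
    next
      case 2
      then have a: "v $ a = - 2 * (v $ d + v $ e)"
        by algebra
      then have "(v $ d + v $ e) ^ 4 = 0"
        using root[of a] p prod unfolding quartic_def by algebra
      with a prod ne show ?thesis
        by (auto simp: add_eq_0_iff2)
    qed
  next
    case (4 a b c d e)
    have "(v $ e)\<^sup>2 = 0"
      using r3[OF 4(4)] P[OF 4(1), unfolded 4(2,3)] by algebra
    with 4 show ?thesis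
      by (intro in_pairing_lineI[of a b c d e]) auto
  next
    case (5 a b c d e)
    note p = P[OF 5(1), unfolded 5(2,3,4)]
    have "(v $ e) ^ 3 * (8 * v $ a - 5 * v $ e) = 0"
      using root[of a] p unfolding quartic_def by algebra
    moreover have "v $ e = 0" if "8 * v $ a = 5 * v $ e"
    proof -
      have "(v $ e) ^ 4 = 0"
        using that root[of e] p unfolding quartic_def by algebra
      then show ?thesis by simp
    qed
    ultimately have "v $ e = 0"
      by auto
    with 5 show ?thesis
      by (intro in_pairing_lineI[of a b c d e]) auto
  next
    case (6 a b c d e)
    have "(v $ a) ^ 4 = 0"
      using root[of d] P[OF 6(1), unfolded 6(2,3,4)] unfolding quartic_def by algebra
    with 6 show ?thesis
      by (intro in_pairing_lineI[of d e a b c]) auto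
  next
    case (7 a b c d e)
    have "(v $ a) ^ 4 = 0"
      using root[of a] P[OF 7(1), unfolded 7(2,3,4,5)] unfolding quartic_def by algebra
    with 7 show ?thesis
      by (intro in_pairing_lineI[of a b c d e]) auto
  qed
qed

section \<open>The fifteen lines\<close>

lemma vec_5_eqI:
  assumes "distinct [a, b, c, d, e]"
    and "v $ a = w $ a" "v $ b = w $ b" "v $ c = w $ c" "v $ d = w $ d" "v $ e = w $ e"
  shows "v = (w :: 'a ^ 5)"
proof -
  have "v $ i = w $ i" for i
  proof -
    have "i \<in> {a, b, c, d, e}"
      using UNIV_5_distinct[OF assms(1)] by blast
    with assms(2-) show ?thesis
      by blast
  qed
  then show ?thesis
    by (simp add: vec_eq_iff)
qed

text \<open>These renamings generate a group of order 8; the 120 index tuples therefore describe at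
  most 15 lines.\<close>

lemma pairing_line_swap:
  "pairing_line b a c d e = pairing_line a b c d e"
  "pairing_line a b d c e = pairing_line a b c d e"
  "pairing_line c d a b e = pairing_line a b c d e"
  unfolding pairing_line_def by auto

text \<open>A point with two distinct nonzero values determines its line: its zero coordinate is
  \<open>e\<close>, and equal coordinates form the pairs. The second conclusion keeps the indices,
  for the count.\<close>

lemma pairing_line_eqI:
  assumes "distinct [a, b, c, d, e]" "distinct [a', b', c', d', e']"
    and v: "v \<in> pairing_line a b c d e" "v \<in> pairing_line a' b' c' d' e'"
      "v $ a \<noteq> v $ c" "v $ a \<noteq> 0" "v $ c \<noteq> 0"
  shows "pairing_line a' b' c' d' e' = pairing_line a b c d e"
    and "e' = e \<and> ({a', b'} = {a, b} \<or> {a', b'} = {c, d})"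
proof -
  have eq: "v $ b = v $ a" "v $ d = v $ c" "v $ e = 0" "v $ b' = v $ a'" "v $ d' = v $ c'" "v $ e' = 0"
    using v by (auto simp: pairing_line_def)
  have U: "i \<in> {a, b, c, d, e}" for i
    using UNIV_5_distinct[OF assms(1)] by auto
  have e: "e' = e"
    using U[of e'] eq v(3-5) by auto
  then have R: "a' \<in> {a, b, c, d}" "b' \<in> {a, b, c, d}" "c' \<in> {a, b, c, d}" "d' \<in> {a, b, c, d}"
    using U[of a'] U[of b'] U[of c'] U[of d'] assms(2) by auto
  have "{a', b'} = {a, b} \<and> {c', d'} = {c, d} \<or> {a', b'} = {c, d} \<and> {c', d'} = {a, b}"
    using R eq v(3) assms(2) by (auto simp: doubleton_eq_iff)
  then show "e' = e \<and> ({a', b'} = {a, b} \<or> {a', b'} = {c, d})"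
    "pairing_line a' b' c' d' e' = pairing_line a b c d e"
    using e by (auto simp: doubleton_eq_iff pairing_line_swap)
qed

lemma card_pairing_lines: "card pairing_lines = 15"
proof -
  \<comment> \<open>One representative of each line: for each \<open>e\<close>, the three ways to
    split the other four indices into pairs.\<close>
  define T :: "(5 \<times> 5 \<times> 5 \<times> 5 \<times> 5) list" where "T =
    [(1,2,3,4,5), (1,3,2,4,5), (1,4,2,3,5), (1,2,3,5,4), (1,3,2,5,4), (1,5,2,3,4),
     (1,2,4,5,3), (1,4,2,5,3), (1,5,2,4,3), (1,3,4,5,2), (1,4,3,5,2), (1,5,3,4,2),
     (2,3,4,5,1), (2,4,3,5,1), (2,5,3,4,1)]"
  let ?L = "\<lambda>(a, b, c, d, e). pairing_line a b c d e"
  have all: "\<forall>e\<in>{1,2,3,4,5}. \<forall>a\<in>{1,2,3,4,5} - {e}. \<forall>b\<in>{1,2,3,4,5} - {e, a}.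
    \<forall>c\<in>{1,2,3,4,5} - {e, a, b}. \<forall>d\<in>{1,2,3,4,5} - {e, a, b, c}. pairing_line a b c d e \<in> ?L ` set T"
    by (simp add: T_def insert_Diff_if pairing_line_swap)
  have mem: "pairing_line a b c d e \<in> ?L ` set T" if "distinct [a, b, c, d, e]" for a b c d e
    using that by (intro all[folded UNIV_5, THEN bspec, THEN bspec, THEN bspec, THEN bspec, THEN bspec]) auto
  have T: "distinct [a, b, c, d, e]" if "(a, b, c, d, e) \<in> set T" for a b c d e
    using that by (auto simp: T_def)
  have lines: "pairing_lines = ?L ` set T"
  proof (intro equalityI subsetI)
    show "L \<in> ?L ` set T" if "L \<in> pairing_lines" for L
      using that mem unfolding pairing_lines_def by blast
    show "L \<in> pairing_lines" if L: "L \<in> ?L ` set T" for L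
    proof -
      obtain t where "L = ?L t" "t \<in> set T"
        using L by (rule imageE)
      moreover obtain a b c d e where "t = (a, b, c, d, e)"
        by (cases t)
      ultimately have "distinct [a, b, c, d, e]" "L = pairing_line a b c d e"
        using T[of a b c d e] by simp_all
      then show ?thesis
        unfolding pairing_lines_def by blast
    qed
  qed
  have inj: "inj_on ?L (set T)"
  proof (rule inj_onI)
    fix t t' assume tt: "t \<in> set T" "t' \<in> set T" "?L t = ?L t'"
    obtain a b c d e where t: "t = (a, b, c, d, e)"
      by (cases t)
    obtain a' b' c' d' e' where t': "t' = (a', b', c', d', e')"
      by (cases t')
    have in_T: "(a, b, c, d, e) \<in> set T" "(a', b', c', d', e') \<in> set T"
      and eq: "pairing_line a b c d e = pairing_line a' b' c' d' e'"
      using tt unfolding t t' by simp_all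
    have D: "distinct [a, b, c, d, e]" "distinct [a', b', c', d', e']"
      using in_T T by blast+
    \<comment> \<open>A general point of the first line, as \<open>pairing_line_eqI\<close>
      requires.\<close>
    define v :: "complex ^ 5" where "v = (\<chi> i. if i \<in> {a, b} then 1 else if i \<in> {c, d} then 2 else 0)"
    have "v \<in> pairing_line a b c d e" "v $ a \<noteq> v $ c" "v $ a \<noteq> 0" "v $ c \<noteq> 0"
      using D by (auto simp: v_def pairing_line_def)
    then have key: "e' = e \<and> ({a', b'} = {a, b} \<or> {a', b'} = {c, d})"
      using pairing_line_eqI(2)[OF D] eq by simp
    have uniq: "\<forall>(a, b, c, d, e)\<in>set T. \<forall>(a', b', c', d', e')\<in>set T.
      e' = e \<and> ({a', b'} = {a, b} \<or> {a', b'} = {c, d}) \<longrightarrow> (a, b, c, d, e) = (a', b', c', d', e')"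
      by (simp add: T_def doubleton_eq_iff)
    show "t = t'"
      unfolding t t' using bspec[OF bspec[OF uniq in_T(1), unfolded prod.case] in_T(2), unfolded prod.case] key
      by simp
  qed
  show ?thesis
    unfolding lines card_image[OF inj] by (simp add: T_def)
qed

text \<open>Exchanging \<open>a\<close> and \<open>b\<close> changes the sign of \<open>p\<close>,
  so only even powers of \<open>p\<close> occur, and likewise for \<open>q\<close>; at
  \<open>p = q = 0\<close> all terms below \<open>t ^ 3\<close> cancel. The mixed terms are
  collected in the coefficient of \<open>p\<close> squared. At \<open>p = q = t = 0\<close> the
  three coefficients are 128 s^2 (s - u), 128 u^2 (u - s) and 16 s u, nonzero unless
  \<open>s = 0\<close>, \<open>u = 0\<close> or \<open>s = u\<close>.\<close>

lemma quintic_near_pairing_line: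
  assumes "distinct [a, b, c, d, e]"
    and "v $ a = s + p" "v $ b = s - p" "v $ c = u + q" "v $ d = u - q" "v $ e = t"
  shows "quintic v =
    p\<^sup>2 * (128 * s\<^sup>2 * (s - u) + 64 * s * (u - s) * t + 16 * (u - s) * t\<^sup>2 - 8 * t ^ 3
      - 64 * (s + u) * q\<^sup>2 + 32 * q\<^sup>2 * t + (96 * s - 32 * u) * p\<^sup>2 - 16 * p\<^sup>2 * t) +
    q\<^sup>2 * (128 * u\<^sup>2 * (u - s) + 64 * u * (s - u) * t + 16 * (s - u) * t\<^sup>2 - 8 * t ^ 3
      + (96 * u - 32 * s) * q\<^sup>2 - 16 * q\<^sup>2 * t) +
    t ^ 3 * (16 * s * u - 10 * (s + u) * t + 7 * t\<^sup>2)"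
    (is "_ = ?r")
proof -
  have "15 * quintic v = 15 * ?r"
    unfolding quintic_power_sums power_sum_distinct[OF assms(1)] assms(2-) by algebra
  then show ?thesis
    by (rule mult_left_cancel[THEN iffD1, rotated]) simp
qed

lemma subspace_pairing_line: "vec.subspace (pairing_line a b c d e)"
  unfolding vec.subspace_def pairing_line_def by auto

lemma dim_pairing_line:
  assumes "distinct [a, b, c, d, e]"
  shows "vec.dim (pairing_line a b c d e) = 2"
proof (rule vec.dim_unique)
  define x y :: "complex ^ 5" where "x = axis a 1 + axis b 1" and "y = axis c 1 + axis d 1"
  have xy: "x $ a = 1" "x $ c = 0" "y $ a = 0" "y $ c = 1" "x $ b = 1" "x $ d = 0" "x $ e = 0"
    "y $ b = 0" "y $ d = 1" "y $ e = 0"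
    using assms by (auto simp: x_def y_def axis_def)
  show "{x, y} \<subseteq> pairing_line a b c d e"
    using xy by (auto simp: pairing_line_def)
  show "pairing_line a b c d e \<subseteq> vec.span {x, y}"
  proof
    fix v assume v: "v \<in> pairing_line a b c d e"
    then have "v = v $ a *s x + v $ c *s y"
      using xy by (intro vec_5_eqI[OF assms]) (simp_all add: pairing_line_def)
    also have "\<dots> \<in> vec.span {x, y}"
      by (intro vec.span_add vec.span_scale vec.span_base) auto
    finally show "v \<in> vec.span {x, y}" .
  qed
  have "x \<noteq> y"
    using xy by (metis zero_neq_one)
  then show "card {x, y} = 2"
    by simp
  show "vec.independent {x, y}"
  proof (rule vec.independent_if_scalars_zero)
    fix f v assume "(\<Sum>v\<in>{x, y}. f v *s v) = 0" and v: "v \<in> {x, y}"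
    then have "f x *s x + f y *s y = 0"
      using \<open>x \<noteq> y\<close> by simp
    then have "(f x *s x + f y *s y) $ a = 0" "(f x *s x + f y *s y) $ c = 0"
      by simp_all
    then show "f v = 0"
      using xy v by auto
  qed simp
qed

section \<open>Cusps\<close>

lemma has_derivative_vecI:
  fixes f :: "'a::real_normed_vector \<Rightarrow> 'b::euclidean_space ^ 'n"
  assumes "\<And>i. ((\<lambda>x. f x $ i) has_derivative (\<lambda>u. f' u $ i)) (at x within S)"
  shows "(f has_derivative f') (at x within S)"
  by (subst has_derivative_componentwise_within)
    (auto simp: Basis_vec_def inner_axis intro!: has_derivative_inner_left assms)

text \<open>Near 0, \<open>f\<close> is a unit times the model polynomial, composed with \<psi>, and
  the model vanishes to second order at \<open>\<psi> 0 = 0\<close>.\<close>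

lemma A2_singularity_critical:
  assumes "A2_singularity f" and D: "(f has_derivative D) (at 0)"
  shows "f 0 = 0" "D = (\<lambda>u. 0)"
proof -
  obtain U V e and \<phi> \<psi> :: "complex ^ 3 \<Rightarrow> complex ^ 3"
    where "open U" "open V" "0 \<in> U" "0 \<in> V" "\<phi> 0 = 0"
    and hom: "homeomorphism U V \<phi> \<psi>" and \<psi>: "holomorphic_map V \<psi>" and e: "holomorphic_fun U e"
    and f: "\<And>z. z \<in> U \<Longrightarrow> f (\<phi> z) = e z * ((z $ 1)\<^sup>2 + (z $ 2)\<^sup>2 + (z $ 3) ^ 3)"
    using assms(1) unfolding A2_singularity_def by blast
  have \<psi>0: "\<psi> 0 = 0"
    using homeomorphism_apply1[OF hom \<open>0 \<in> U\<close>] \<open>\<phi> 0 = 0\<close> by simp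
  show "f 0 = 0"
    using f[OF \<open>0 \<in> U\<close>] \<open>\<phi> 0 = 0\<close> by simp
  obtain E where E: "(e has_derivative E) (at (\<psi> 0))"
    using e \<open>0 \<in> U\<close> \<psi>0 unfolding holomorphic_fun_def by auto
  have "\<forall>i. \<exists>d. ((\<lambda>w. \<psi> w $ i) has_derivative d) (at 0)"
    using \<psi> \<open>0 \<in> V\<close> unfolding holomorphic_map_def holomorphic_fun_def by blast
  then obtain d where d: "\<And>i. ((\<lambda>w. \<psi> w $ i) has_derivative d i) (at 0)"
    unfolding choice_iff by blast
  have \<psi>': "(\<psi> has_derivative (\<lambda>u. \<chi> i. d i u)) (at 0)"
    by (rule has_derivative_vecI) (simp add: d)
  have "((\<lambda>w. e (\<psi> w) * ((\<psi> w $ 1)\<^sup>2 + (\<psi> w $ 2)\<^sup>2 + (\<psi> w $ 3) ^ 3)) has_derivative (\<lambda>u. 0)) (at 0)"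
    by (rule has_derivative_eq_rhs, (rule derivative_intros d has_derivative_compose[OF \<psi>' E])+)
      (simp add: \<psi>0)
  then have "(f has_derivative (\<lambda>u. 0)) (at 0)"
  proof (rule has_derivative_transform_within_open[OF _ \<open>open V\<close> \<open>0 \<in> V\<close>])
    fix w assume "w \<in> V"
    moreover from this have "\<psi> w \<in> U"
      using hom by (metis homeomorphism_image2 imageI)
    ultimately show "e (\<psi> w) * ((\<psi> w $ 1)\<^sup>2 + (\<psi> w $ 2)\<^sup>2 + (\<psi> w $ 3) ^ 3) = f w"
      using f[of "\<psi> w"] homeomorphism_apply2[OF hom] by simp
  qed
  with D show "D = (\<lambda>u. 0)"
    by (rule has_derivative_unique)
qed

text \<open>The real inverse function theorem suffices: the derivative of the local inverse is the
  inverse of a complex linear bijection, hence itself complex linear.\<close>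

lemma holomorphic_inverse_function:
  fixes \<Psi> :: "complex ^ 'n \<Rightarrow> complex ^ 'n"
  assumes "open U" "x \<in> U"
    and deriv: "\<And>z. z \<in> U \<Longrightarrow> (\<Psi> has_derivative (\<lambda>u. M z *v u)) (at z)"
    and cont: "\<And>i j. continuous_on U (\<lambda>z. M z $ i $ j)"
    and "N ** M x = mat 1"
  obtains U' V \<Phi> where "open U'" "U' \<subseteq> U" "x \<in> U'" "open V" "\<Psi> x \<in> V"
    "homeomorphism U' V \<Psi> \<Phi>" "holomorphic_map U' \<Psi>" "holomorphic_map V \<Phi>"
proof -
  have bl: "bounded_linear (\<lambda>u. A *v u)" for A :: "complex ^ 'n ^ 'n"
    unfolding linear_conv_bounded_linear[symmetric]
    by (rule linearI) (simp_all add: vec_eq_iff matrix_vector_mult_def scaleR_sum_right distrib_left sum.distrib)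
  define f' where "f' z = Blinfun (\<lambda>u. M z *v u)" for z
  have f': "blinfun_apply (f' z) = (\<lambda>u. M z *v u)" for z
    unfolding f'_def by (rule bounded_linear_Blinfun_apply[OF bl])
  have 1: "(\<Psi> has_derivative blinfun_apply (f' z)) (at z)" if "z \<in> U" for z
    unfolding f' by (rule deriv[OF that])
  have 2: "continuous_on U f'"
    by (rule continuous_on_blinfun_componentwise)
      (auto simp: f' matrix_vector_mult_def intro!: continuous_intros cont)
  have 3: "Blinfun (\<lambda>u. N *v u) o\<^sub>L f' x = id_blinfun"
    by (rule blinfun_eqI)
      (simp add: f' bounded_linear_Blinfun_apply[OF bl] matrix_vector_mul_assoc assms)
  obtain U' V \<Phi> g' where UV: "open U'" "U' \<subseteq> U" "x \<in> U'" "open V" "\<Psi> x \<in> V" "homeomorphism U' V \<Psi> \<Phi>"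
    and g: "\<And>y. y \<in> V \<Longrightarrow> (\<Phi> has_derivative g' y) (at y)"
      "\<And>y. y \<in> V \<Longrightarrow> g' y = inv (blinfun_apply (f' (\<Phi> y)))"
      "\<And>y. y \<in> V \<Longrightarrow> bij (blinfun_apply (f' (\<Phi> y)))"
    by (rule inverse_function_theorem[OF \<open>open U\<close> 1 2 \<open>x \<in> U\<close> 3], assumption) (rule that; assumption)
  have "holomorphic_map U' \<Psi>"
    unfolding holomorphic_map_def holomorphic_fun_def
  proof (intro allI ballI exI conjI)
    fix i z assume "z \<in> U'"
    with UV have "z \<in> U" by blast
    then show "((\<lambda>z. \<Psi> z $ i) has_derivative (\<lambda>u. (M z *v u) $ i)) (at z)"
      by (intro bounded_linear.has_derivative[OF bounded_linear_vec_nth] deriv)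
    show "(M z *v (c *s u)) $ i = c * (M z *v u) $ i" for c u
      by (simp add: matrix_vector_mult_def sum_distrib_left mult_ac)
  qed
  moreover have "holomorphic_map V \<Phi>"
    unfolding holomorphic_map_def holomorphic_fun_def
  proof (intro allI ballI exI conjI)
    fix i y assume y: "y \<in> V"
    then show "((\<lambda>y. \<Phi> y $ i) has_derivative (\<lambda>u. g' y u $ i)) (at y)"
      by (intro bounded_linear.has_derivative[OF bounded_linear_vec_nth] g)
    fix c u
    have g': "M (\<Phi> y) *v g' y w = w" for w
      using bij_is_surj[OF g(3)[OF y]] unfolding g(2)[OF y] f' by (rule surj_f_inv_f)
    have "M (\<Phi> y) *v (c *s g' y u) = c *s (M (\<Phi> y) *v g' y u)"
      by (simp add: vec_eq_iff matrix_vector_mult_def sum_distrib_left mult_ac)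
    then have "M (\<Phi> y) *v g' y (c *s u) = M (\<Phi> y) *v (c *s g' y u)"
      by (simp add: g')
    then have "g' y (c *s u) = c *s g' y u"
      using bij_is_inj[OF g(3)[OF y]] unfolding f' by (rule injD[rotated])
    then show "g' y (c *s u) $ i = c * g' y u $ i"
      by simp
  qed
  ultimately show thesis
    using UV that by blast
qed

text \<open>The root is a fixed root of \<open>h 0\<close> times a root of \<open>h z / h 0\<close>.
  The quotient is 1 at the origin, so near it the principal logarithm stays off its branch
  cut.\<close>

lemma polynomial_root_branch:
  fixes h :: "complex ^ 'n \<Rightarrow> complex"
  assumes h: "polynomial_fun h" "h 0 \<noteq> 0" and "n > 0"
  obtains U r r' where "open U" "0 \<in> U" "\<And>z. z \<in> U \<Longrightarrow> r z ^ n = h z"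
    "\<And>z. z \<in> U \<Longrightarrow> (r has_derivative (\<lambda>u. \<Sum>i\<in>UNIV. r' z i * u $ i)) (at z)"
    "\<And>i. continuous_on U (\<lambda>z. r' z i)"
proof -
  define U where "U = (\<lambda>z. h z / h 0) -` (- \<real>\<^sub>\<le>\<^sub>0)"
  define r where "r z = exp (Ln (h 0) / n) * exp (Ln (h z / h 0) / n)" for z
  define r' where "r' z i = r z * (partial i h z / (n * h z))" for z i
  have "continuous_on UNIV (\<lambda>z. h z / h 0)"
    using h by (intro continuous_intros polynomial_fun_continuous) auto
  then have "open U"
    unfolding U_def using closed_nonpos_Reals_complex by (intro open_vimage) auto
  have "0 \<in> U"
    using h by (simp add: U_def)
  have nz: "h z \<noteq> 0" if "z \<in> U" for z
    using that by (auto simp: U_def)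
  have r: "(r has_derivative (\<lambda>u. \<Sum>i\<in>UNIV. r' z i * u $ i)) (at z)" if "z \<in> U" for z
  proof -
    have "((\<lambda>w. exp (Ln (h 0) / n) * exp (Ln (w / h 0) / n)) has_field_derivative
        r z / (n * h z)) (at (h z))"
      using that h nz[OF that] \<open>n > 0\<close> unfolding U_def r_def
      by (auto intro!: derivative_eq_intros simp: field_simps)
    then have "((\<lambda>w. exp (Ln (h 0) / n) * exp (Ln (w / h 0) / n)) has_derivative
        (\<lambda>u. r z / (n * h z) * u)) (at (h z))"
      by (rule has_field_derivative_imp_has_derivative)
    from has_derivative_compose[OF polynomial_fun_has_derivative[OF h(1)] this] show ?thesis
      unfolding r_def[abs_def] r'_def by (simp add: sum_distrib_left sum_divide_distrib mult_ac)
  qed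
  moreover have "continuous_on U (\<lambda>z. r' z i)" for i
    unfolding r'_def using nz \<open>n > 0\<close> h(1)
    by (intro continuous_intros polynomial_fun_continuous polynomial_fun_partial
        continuous_at_imp_continuous_on ballI has_derivative_continuous[OF r]) auto
  moreover have "r z ^ n = h z" if "z \<in> U" for z
    using nz[OF that] h \<open>n > 0\<close>
    by (simp add: r_def power_mult_distrib exp_of_nat_mult[symmetric])
  ultimately show thesis
    using that[of U r r'] \<open>open U\<close> \<open>0 \<in> U\<close> by blast
qed

text \<open>Each coordinate is multiplied by a square or cube root of its coefficient. In the new
  coordinates \<Psi> the function is exactly the model polynomial.\<close>

lemma A2_singularityI:
  fixes D G A :: "complex ^ 3 \<Rightarrow> complex"
  assumes "polynomial_fun D" "polynomial_fun G" "polynomial_fun A"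
    and "D 0 \<noteq> 0" "G 0 \<noteq> 0" "A 0 \<noteq> 0"
    and f: "\<And>z. f z = (z $ 1)\<^sup>2 * D z + (z $ 2)\<^sup>2 * G z + (z $ 3) ^ 3 * A z"
  shows "A2_singularity f"
proof -
  obtain U1 d d' where U1: "open U1" "0 \<in> U1" "\<And>z. z \<in> U1 \<Longrightarrow> (d z)\<^sup>2 = D z"
      "\<And>z. z \<in> U1 \<Longrightarrow> (d has_derivative (\<lambda>u. \<Sum>i\<in>UNIV. d' z i * u $ i)) (at z)"
      "\<And>i. continuous_on U1 (\<lambda>z. d' z i)"
    by (rule polynomial_root_branch[OF assms(1,4), where n = 2], simp) (rule that; assumption)
  obtain U2 g g' where U2: "open U2" "0 \<in> U2" "\<And>z. z \<in> U2 \<Longrightarrow> (g z)\<^sup>2 = G z"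
      "\<And>z. z \<in> U2 \<Longrightarrow> (g has_derivative (\<lambda>u. \<Sum>i\<in>UNIV. g' z i * u $ i)) (at z)"
      "\<And>i. continuous_on U2 (\<lambda>z. g' z i)"
    by (rule polynomial_root_branch[OF assms(2,5), where n = 2], simp) (rule that; assumption)
  obtain U3 a a' where U3: "open U3" "0 \<in> U3" "\<And>z. z \<in> U3 \<Longrightarrow> a z ^ 3 = A z"
      "\<And>z. z \<in> U3 \<Longrightarrow> (a has_derivative (\<lambda>u. \<Sum>i\<in>UNIV. a' z i * u $ i)) (at z)"
      "\<And>i. continuous_on U3 (\<lambda>z. a' z i)"
    by (rule polynomial_root_branch[OF assms(3,6), where n = 3], simp) (rule that; assumption)
  define U where "U = U1 \<inter> U2 \<inter> U3"
  define r where "r z k = (if k = 1 then d z else if k = 2 then g z else a z)" for z and k :: 3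
  define r' where "r' z k = (if k = 1 then d' z else if k = 2 then g' z else a' z)" for z and k :: 3
  have U: "open U" "0 \<in> U"
    using U1(1,2) U2(1,2) U3(1,2) by (auto simp: U_def)
  have r: "((\<lambda>z. r z k) has_derivative (\<lambda>u. \<Sum>i\<in>UNIV. r' z k i * u $ i)) (at z)" if "z \<in> U" for z k
    using U1(4) U2(4) U3(4) that unfolding r_def r'_def U_def
    by (cases "k = 1"; cases "k = 2") simp_all
  have r': "continuous_on U (\<lambda>z. r' z k i)" for k i
    using U1(5) U2(5) U3(5) unfolding r'_def U_def
    by (cases "k = 1"; cases "k = 2") (auto intro: continuous_on_subset)
  have r0: "r 0 k \<noteq> 0" for k
    using U1(3)[OF U1(2)] U2(3)[OF U2(2)] U3(3)[OF U3(2)] assms(4-6) by (auto simp: r_def)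
  define \<Psi> where "\<Psi> z = (\<chi> k. z $ k * r z k)" for z
  define M where "M z = (\<chi> k i. (if i = k then r z k else 0) + z $ k * r' z k i)" for z
  \<comment> \<open>The second summand of the Jacobian \<open>M\<close> carries the factor
    \<open>z $ k\<close>, so \<open>M 0\<close> is diagonal with the nonzero entries
    \<open>r 0 k\<close>.\<close>
  have deriv: "(\<Psi> has_derivative (\<lambda>u. M z *v u)) (at z)" if "z \<in> U" for z
  proof (rule has_derivative_vecI)
    fix k
    have "((\<lambda>z. z $ k * r z k) has_derivative
        (\<lambda>u. z $ k * (\<Sum>i\<in>UNIV. r' z k i * u $ i) + u $ k * r z k)) (at z)"
      by (intro has_derivative_mult r that bounded_linear_imp_has_derivative bounded_linear_vec_nth)
    moreover have "(M z *v u) $ k = z $ k * (\<Sum>i\<in>UNIV. r' z k i * u $ i) + u $ k * r z k" for u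
    proof -
      have "(M z *v u) $ k = (\<Sum>i\<in>UNIV. z $ k * (r' z k i * u $ i) + (if i = k then u $ k * r z k else 0))"
        unfolding M_def matrix_vector_mult_def vec_lambda_beta
        by (intro sum.cong) (auto simp: algebra_simps)
      then show ?thesis
        by (simp add: sum.distrib sum_distrib_left)
    qed
    ultimately show "((\<lambda>z. \<Psi> z $ k) has_derivative (\<lambda>u. (M z *v u) $ k)) (at z)"
      by (simp add: \<Psi>_def)
  qed
  have cont: "continuous_on U (\<lambda>z. M z $ k $ i)" for k i
  proof -
    have "continuous_on U (\<lambda>z. r z k)"
      by (intro continuous_at_imp_continuous_on ballI has_derivative_continuous[OF r])
    then show ?thesis
      unfolding M_def using r' by (cases "i = k") (auto intro!: continuous_intros)
  qed
  have inv: "(\<chi> k i. if i = k then inverse (r 0 k) else 0) ** M 0 = mat 1"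
  proof -
    have "(\<Sum>j\<in>UNIV. (if j = k then inverse (r 0 k) else 0) * M 0 $ j $ i) = mat 1 $ k $ i" for k i
    proof -
      have "(\<Sum>j\<in>UNIV. (if j = k then inverse (r 0 k) else 0) * M 0 $ j $ i) =
          (\<Sum>j\<in>UNIV. if j = k then inverse (r 0 k) * M 0 $ k $ i else 0)"
        by (intro sum.cong) auto
      then show ?thesis
        using r0 by (auto simp: M_def mat_def)
    qed
    then show ?thesis
      by (simp add: matrix_matrix_mult_def vec_eq_iff)
  qed
  obtain U' V \<Phi> where UV: "open U'" "U' \<subseteq> U" "0 \<in> U'" "open V" "\<Psi> 0 \<in> V" "homeomorphism U' V \<Psi> \<Phi>"
      "holomorphic_map U' \<Psi>" "holomorphic_map V \<Phi>"
    by (rule holomorphic_inverse_function[OF U deriv cont inv], assumption) (rule that; assumption)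
  have "\<Psi> 0 = 0"
    by (simp add: \<Psi>_def vec_eq_iff)
  have "f (\<Phi> z) = (z $ 1)\<^sup>2 + (z $ 2)\<^sup>2 + (z $ 3) ^ 3" if "z \<in> V" for z
  proof -
    have "\<Psi> (\<Phi> z) = z"
      using UV(6) that by (rule homeomorphism_apply2)
    then have z: "z $ k = \<Phi> z $ k * r (\<Phi> z) k" for k
      by (metis \<Psi>_def vec_lambda_beta)
    have "\<Phi> z \<in> U"
      using UV(2,6) that by (metis homeomorphism_image2 imageI subsetD)
    then show ?thesis
      using U1(3)[of "\<Phi> z"] U2(3)[of "\<Phi> z"] U3(3)[of "\<Phi> z"]
      by (simp add: z[of 1] z[of 2] z[of 3] f r_def power_mult_distrib U_def)
  qed
  moreover have "holomorphic_fun V (\<lambda>z. 1)"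
    unfolding holomorphic_fun_def by (auto intro!: exI[of _ "\<lambda>u. 0"])
  moreover have "\<Phi> 0 = 0"
    using homeomorphism_apply1[OF UV(6) UV(3)] \<open>\<Psi> 0 = 0\<close> by simp
  moreover have "homeomorphism V U' \<Phi> \<Psi>"
    using UV(6) by (rule homeomorphism_symD)
  \<comment> \<open>The coordinate change asked for is the inverse \<Phi>, so \<open>V\<close> and
    \<open>U'\<close> exchange places with the sets of the definition; the unit is 1.\<close>
  ultimately show ?thesis
    unfolding A2_singularity_def using UV \<open>\<Psi> 0 = 0\<close>
    by (intro exI[of _ V] exI[of _ U'] exI[of _ "\<lambda>z. 1"] exI[of _ \<Phi>] exI[of _ \<Psi>]) simp
qed

section \<open>The dual variety of the quintic\<close>

interpretation fun_space: vector_space "\<lambda>c (f :: 'a \<Rightarrow> complex) x. c * f x"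
  by unfold_locales (auto simp: fun_eq_iff algebra_simps)

text \<open>Setting the function to 0 off the cone makes two forms that agree on the threefold equal
  as functions; this replaces the quotient by the quintic.\<close>

definition on_threefold :: "(complex ^ 5 \<Rightarrow> complex) \<Rightarrow> complex ^ 5 \<Rightarrow> complex" where
  "on_threefold f v = (if quintic v = 0 then f v else 0)"

definition reduced_monomials :: "nat \<Rightarrow> (complex ^ 5 \<Rightarrow> complex) set" where
  "reduced_monomials D = {on_threefold (\<lambda>v. v $ 1 ^ k * v $ 2 ^ i * v $ 3 ^ j * v $ 4 ^ l * v $ 5 ^ m) |
    k i j l m. k \<le> 4 \<and> k + i + j + l + m = D}"

definition threefold_forms :: "nat \<Rightarrow> (complex ^ 5 \<Rightarrow> complex) set" where
  "threefold_forms D = fun_space.span (reduced_monomials D)"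

text \<open>Stands for a form of degree \<open>d\<close> acting on the graded space. Closure under
  sums and products is immediate, so only the coordinates have to be checked on monomials.\<close>

definition multiplier :: "nat \<Rightarrow> (complex ^ 5 \<Rightarrow> complex) \<Rightarrow> bool" where
  "multiplier d g \<longleftrightarrow> (\<forall>D. \<forall>f\<in>threefold_forms D. (\<lambda>v. g v * f v) \<in> threefold_forms (D + d))"

lemma threefold_forms_add:
  "f \<in> threefold_forms D \<Longrightarrow> g \<in> threefold_forms D \<Longrightarrow> (\<lambda>v. f v + g v) \<in> threefold_forms D"
  using fun_space.span_add[of f "reduced_monomials D" g]
  by (simp add: threefold_forms_def plus_fun_def)

lemma threefold_forms_scale:
  "f \<in> threefold_forms D \<Longrightarrow> (\<lambda>v. c * f v) \<in> threefold_forms D"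
  using fun_space.span_scale[of f "reduced_monomials D" c] by (simp add: threefold_forms_def)

lemma threefold_forms_monomial:
  assumes "k \<le> 4" "k + i + j + l + m = D"
  shows "on_threefold (\<lambda>v. v $ 1 ^ k * v $ 2 ^ i * v $ 3 ^ j * v $ 4 ^ l * v $ 5 ^ m) \<in> threefold_forms D"
  unfolding threefold_forms_def using assms
  by (intro fun_space.span_base) (unfold reduced_monomials_def, blast)

text \<open>The first exponent takes five values and the last is determined by the others, so the
  dimension grows only like the cube of the degree.\<close>

lemma card_reduced_monomials:
  "finite (reduced_monomials D)" "card (reduced_monomials D) \<le> 5 * (D + 1) ^ 3"
proof -
  let ?I = "{..4::nat} \<times> {..D} \<times> {..D} \<times> {..D}"
  let ?f = "\<lambda>(k, i, j, l). on_threefold (\<lambda>v. v $ 1 ^ k * v $ 2 ^ i * v $ 3 ^ j * v $ 4 ^ l * v $ 5 ^ (D - k - i - j - l))"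
  have sub: "reduced_monomials D \<subseteq> ?f ` ?I"
  proof
    fix f assume "f \<in> reduced_monomials D"
    then obtain k i j l m where *: "k \<le> 4" "k + i + j + l + m = D"
      "f = on_threefold (\<lambda>v. v $ 1 ^ k * v $ 2 ^ i * v $ 3 ^ j * v $ 4 ^ l * v $ 5 ^ m)"
      unfolding reduced_monomials_def by blast
    have "m = D - k - i - j - l"
      using *(2) by simp
    with * have "f = ?f (k, i, j, l)"
      by simp
    moreover have "(k, i, j, l) \<in> ?I"
      using * by simp
    ultimately show "f \<in> ?f ` ?I"
      by (rule image_eqI)
  qed
  have fin: "finite (?f ` ?I)"
    by (intro finite_imageI) simp
  then show "finite (reduced_monomials D)"
    using sub by (rule finite_subset[rotated])
  have "card (reduced_monomials D) \<le> card (?f ` ?I)"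
    by (rule card_mono[OF fin sub])
  also have "\<dots> \<le> card ?I"
    by (rule card_image_le) simp
  also have "\<dots> = 5 * (D + 1) ^ 3"
    by (simp add: card_cartesian_product power3_eq_cube)
  finally show "card (reduced_monomials D) \<le> 5 * (D + 1) ^ 3" .
qed

section \<open>Multiplication on forms modulo the quintic\<close>

lemma multiplierI:
  assumes "\<And>D f. f \<in> reduced_monomials D \<Longrightarrow> (\<lambda>v. g v * f v) \<in> threefold_forms (D + d)"
  shows "multiplier d g"
  unfolding multiplier_def
proof (intro allI ballI)
  fix D f assume "f \<in> threefold_forms D"
  then have "f \<in> fun_space.span (reduced_monomials D)"
    by (simp add: threefold_forms_def)
  moreover have "fun_space.subspace {f. (\<lambda>v. g v * f v) \<in> threefold_forms (D + d)}"
  proof (rule fun_space.subspaceI)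
    show "0 \<in> {f. (\<lambda>v. g v * f v) \<in> threefold_forms (D + d)}"
      using fun_space.span_zero[of "reduced_monomials (D + d)"]
      by (simp add: threefold_forms_def zero_fun_def)
  next
    fix x y assume "x \<in> {f. (\<lambda>v. g v * f v) \<in> threefold_forms (D + d)}"
      "y \<in> {f. (\<lambda>v. g v * f v) \<in> threefold_forms (D + d)}"
    then show "x + y \<in> {f. (\<lambda>v. g v * f v) \<in> threefold_forms (D + d)}"
      using threefold_forms_add by (fastforce simp: distrib_left)
  next
    fix c x assume "x \<in> {f. (\<lambda>v. g v * f v) \<in> threefold_forms (D + d)}"
    then have "(\<lambda>v. c * (g v * x v)) \<in> threefold_forms (D + d)"
      by (auto intro: threefold_forms_scale)
    then show "(\<lambda>v. c * x v) \<in> {f. (\<lambda>v. g v * f v) \<in> threefold_forms (D + d)}"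
      by (simp add: mult.left_commute)
  qed
  ultimately show "(\<lambda>v. g v * f v) \<in> threefold_forms (D + d)"
    by (rule fun_space.span_induct[where P = "\<lambda>f. (\<lambda>v. g v * f v) \<in> threefold_forms (D + d)"])
      (rule assms)
qed

lemma multiplier_apply:
  "multiplier d g \<Longrightarrow> f \<in> threefold_forms D \<Longrightarrow> D + d = E \<Longrightarrow> (\<lambda>v. g v * f v) \<in> threefold_forms E"
  unfolding multiplier_def by blast

lemma multiplier_mult: "multiplier d f \<Longrightarrow> multiplier e g \<Longrightarrow> multiplier (d + e) (\<lambda>v. f v * g v)"
  unfolding multiplier_def
  by (metis (no_types, lifting) ext add.assoc add.commute mult.assoc)

lemma multiplier_const: "multiplier 0 (\<lambda>v. c)"
  unfolding multiplier_def by (simp add: threefold_forms_scale)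

lemma multiplier_cmult: "multiplier d g \<Longrightarrow> multiplier d (\<lambda>v. c * g v)"
  using multiplier_mult[OF multiplier_const] by simp

lemma multiplier_add: "multiplier d f \<Longrightarrow> multiplier d g \<Longrightarrow> multiplier d (\<lambda>v. f v + g v)"
  unfolding multiplier_def by (simp add: distrib_right threefold_forms_add)

lemma multiplier_diff: "multiplier d f \<Longrightarrow> multiplier d g \<Longrightarrow> multiplier d (\<lambda>v. f v - g v)"
  using multiplier_add[OF _ multiplier_cmult[of d g "-1"]] by simp

lemma multiplier_power: "multiplier d g \<Longrightarrow> multiplier (d * n) (\<lambda>v. g v ^ n)"
  by (induction n) (auto intro: multiplier_mult simp: multiplier_const)

lemma multiplier_cong: "multiplier d g \<Longrightarrow> d = e \<Longrightarrow> multiplier e g"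
  by simp

lemma multiplier_coord_other:
  assumes "i \<noteq> 1"
  shows "multiplier 1 (\<lambda>v. v $ i)"
proof (rule multiplierI)
  fix D f assume "f \<in> reduced_monomials D"
  then obtain k i' j l m where *: "k \<le> 4" "k + i' + j + l + m = D"
    "f = on_threefold (\<lambda>v. v $ 1 ^ k * v $ 2 ^ i' * v $ 3 ^ j * v $ 4 ^ l * v $ 5 ^ m)"
    unfolding reduced_monomials_def by blast
  have "i \<in> {1, 2, 3, 4, 5}"
    using UNIV_5 by blast
  with assms consider "i = 2" | "i = 3" | "i = 4" | "i = 5"
    by blast
  then show "(\<lambda>v. v $ i * f v) \<in> threefold_forms (D + 1)"
  proof cases
    case 1
    then have "(\<lambda>v. v $ i * f v) = on_threefold (\<lambda>v. v $ 1 ^ k * v $ 2 ^ Suc i' * v $ 3 ^ j * v $ 4 ^ l * v $ 5 ^ m)"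
      using *(3) by (auto simp: on_threefold_def fun_eq_iff)
    then show ?thesis
      using threefold_forms_monomial[OF *(1), of "Suc i'" j l m "D + 1"] *(2) by simp
  next
    case 2
    then have "(\<lambda>v. v $ i * f v) = on_threefold (\<lambda>v. v $ 1 ^ k * v $ 2 ^ i' * v $ 3 ^ Suc j * v $ 4 ^ l * v $ 5 ^ m)"
      using *(3) by (auto simp: on_threefold_def fun_eq_iff)
    then show ?thesis
      using threefold_forms_monomial[OF *(1), of i' "Suc j" l m "D + 1"] *(2) by simp
  next
    case 3
    then have "(\<lambda>v. v $ i * f v) = on_threefold (\<lambda>v. v $ 1 ^ k * v $ 2 ^ i' * v $ 3 ^ j * v $ 4 ^ Suc l * v $ 5 ^ m)"
      using *(3) by (auto simp: on_threefold_def fun_eq_iff)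
    then show ?thesis
      using threefold_forms_monomial[OF *(1), of i' j "Suc l" m "D + 1"] *(2) by simp
  next
    case 4
    then have "(\<lambda>v. v $ i * f v) = on_threefold (\<lambda>v. v $ 1 ^ k * v $ 2 ^ i' * v $ 3 ^ j * v $ 4 ^ l * v $ 5 ^ Suc m)"
      using *(3) by (auto simp: on_threefold_def fun_eq_iff)
    then show ?thesis
      using threefold_forms_monomial[OF *(1), of i' j l "Suc m" "D + 1"] *(2) by simp
  qed
qed

text \<open>The quintic is monic up to a constant in the first coordinate, so its fifth power reduces.\<close>

lemma multiplier_coord: "multiplier 1 (\<lambda>v. v $ i)"
proof (cases "i = 1")
  case False
  then show ?thesis by (rule multiplier_coord_other)
next
  case True
  \<comment> \<open>Power sums of the last four coordinates. The \<open>c0\<close>, ...,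
    \<open>c4\<close> below are the coefficients of 15 times the quintic as a polynomial in the
    first coordinate, with leading coefficient 105.\<close>
  define P where "P k v = v $ 2 ^ k + v $ 3 ^ k + v $ 4 ^ k + v $ 5 ^ k" for k and v :: "complex ^ 5"
  have P: "multiplier k (P k)" for k
  proof -
    have "multiplier k (\<lambda>v. v $ i ^ k)" if "i \<noteq> 1" for i
      using multiplier_power[OF multiplier_coord_other[OF that], of k] by simp
    then show ?thesis
      unfolding P_def[abs_def] by (intro multiplier_add) simp_all
  qed
  note P' = multiplier_mult[OF P P] multiplier_mult[OF P multiplier_power[OF P]]
    multiplier_mult[OF multiplier_power[OF P] P] multiplier_power[OF P] P
  define c0 where "c0 v = 60 * (P 1 v * P 2 v ^ 2) - 240 * (P 1 v * P 4 v) + 80 * (P 1 v ^ 2 * P 3 v)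
    - 20 * (P 1 v ^ 3 * P 2 v) + P 1 v ^ 5 - 160 * (P 2 v * P 3 v) + 384 * P 5 v" for v
  define c1 where "c1 v = 160 * (P 1 v * P 3 v) - 60 * (P 1 v ^ 2 * P 2 v) + 5 * P 1 v ^ 4
    + 60 * P 2 v ^ 2 - 240 * P 4 v" for v
  define c2 where "c2 v = 60 * (P 1 v * P 2 v) - 10 * P 1 v ^ 3 - 80 * P 3 v" for v
  define c3 where "c3 v = 30 * P 1 v ^ 2 - 60 * P 2 v" for v
  define c4 where "c4 v = - 75 * P 1 v" for v
  have c: "multiplier 5 c0" "multiplier 4 c1" "multiplier 3 c2" "multiplier 2 c3" "multiplier 1 c4"
    unfolding c0_def[abs_def] c1_def[abs_def] c2_def[abs_def] c3_def[abs_def] c4_def[abs_def]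
    by (intro multiplier_add multiplier_diff multiplier_cmult; rule multiplier_cong, rule P', simp)+
  have quintic: "15 * quintic v = 105 * v $ 1 ^ 5 + c4 v * v $ 1 ^ 4 + c3 v * v $ 1 ^ 3 + c2 v * v $ 1 ^ 2
    + c1 v * v $ 1 + c0 v" for v
    unfolding quintic_power_sums power_sum_def sum_UNIV_5 c0_def c1_def c2_def c3_def c4_def P_def
    by algebra
  show ?thesis
  proof (rule multiplierI)
    fix D f assume "f \<in> reduced_monomials D"
    then obtain k i' j l m where *: "k \<le> 4" "k + i' + j + l + m = D"
      "f = on_threefold (\<lambda>v. v $ 1 ^ k * v $ 2 ^ i' * v $ 3 ^ j * v $ 4 ^ l * v $ 5 ^ m)"
      unfolding reduced_monomials_def by blast
    show "(\<lambda>v. v $ i * f v) \<in> threefold_forms (D + 1)"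
    proof (cases "k = 4")
      case False
      have "(\<lambda>v. v $ i * f v) = on_threefold (\<lambda>v. v $ 1 ^ Suc k * v $ 2 ^ i' * v $ 3 ^ j * v $ 4 ^ l * v $ 5 ^ m)"
        using *(3) True by (auto simp: on_threefold_def fun_eq_iff)
      then show ?thesis
        using threefold_forms_monomial[of "Suc k" i' j l m "D + 1"] *(1,2) False by simp
    next
      case k: True
      define n where "n v = v $ 2 ^ i' * v $ 3 ^ j * v $ 4 ^ l * v $ 5 ^ m" for v :: "complex ^ 5"
      \<comment> \<open>As \<open>k = 4\<close>, the degree \<open>D\<close> is at least 4, and
        \<open>D - 4\<close> is the true degree of \<open>n\<close>.\<close>
      have mon: "on_threefold (\<lambda>v. v $ 1 ^ h * n v) \<in> threefold_forms (h + (D - 4))" if "h \<le> 4" for h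
        using threefold_forms_monomial[OF that, of i' j l m "h + (D - 4)"] *(2) k
        by (simp add: n_def mult.assoc)
      have red: "(\<lambda>v. c v * on_threefold (\<lambda>v. v $ 1 ^ h * n v) v) \<in> threefold_forms (D + 1)"
        if "multiplier d c" "h + d = 5" "h \<le> 4" for h d c
        by (rule multiplier_apply[OF that(1) mon[OF that(3)]]) (use *(2) k that(2) in simp)
      \<comment> \<open>On the threefold the fifth power is solved for by means of the quintic; off
        it both sides are 0.\<close>
      have "(\<lambda>v. v $ i * f v) = (\<lambda>v. - 1 / 105 * (c4 v * on_threefold (\<lambda>v. v $ 1 ^ 4 * n v) v
          + c3 v * on_threefold (\<lambda>v. v $ 1 ^ 3 * n v) v + c2 v * on_threefold (\<lambda>v. v $ 1 ^ 2 * n v) v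
          + c1 v * on_threefold (\<lambda>v. v $ 1 ^ 1 * n v) v + c0 v * on_threefold (\<lambda>v. v $ 1 ^ 0 * n v) v))"
      proof
        fix v
        show "v $ i * f v = - 1 / 105 * (c4 v * on_threefold (\<lambda>v. v $ 1 ^ 4 * n v) v
          + c3 v * on_threefold (\<lambda>v. v $ 1 ^ 3 * n v) v + c2 v * on_threefold (\<lambda>v. v $ 1 ^ 2 * n v) v
          + c1 v * on_threefold (\<lambda>v. v $ 1 ^ 1 * n v) v + c0 v * on_threefold (\<lambda>v. v $ 1 ^ 0 * n v) v)"
          (is "?l = ?r")
        proof (cases "quintic v = 0")
          case True
          have f: "v $ i * f v = v $ 1 ^ 5 * n v"
            using *(3) True \<open>i = 1\<close> k by (simp add: on_threefold_def n_def mult.assoc eval_nat_numeral)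
          have "105 * v $ 1 ^ 5 = - (c4 v * v $ 1 ^ 4 + c3 v * v $ 1 ^ 3 + c2 v * v $ 1 ^ 2
              + c1 v * v $ 1 + c0 v)"
            using quintic[of v] True by algebra
          then have "105 * (v $ i * f v) = - (c4 v * v $ 1 ^ 4 + c3 v * v $ 1 ^ 3 + c2 v * v $ 1 ^ 2
              + c1 v * v $ 1 + c0 v) * n v"
            unfolding f by algebra
          then show ?thesis
            unfolding on_threefold_def if_P[OF True] by algebra
        qed (use *(3) in \<open>simp add: on_threefold_def\<close>)
      qed
      also have "\<dots> \<in> threefold_forms (D + 1)"
        by (intro threefold_forms_scale threefold_forms_add red) (use c in auto)
      finally show ?thesis .
    qed
  qed
qed

lemma multiplier_power_sum: "multiplier k (power_sum k)"
proof -
  have "multiplier k (\<lambda>v. v $ i ^ k)" for i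
    using multiplier_power[OF multiplier_coord, of k] by simp
  then show ?thesis
    unfolding power_sum_def[abs_def] sum_UNIV_5 by (intro multiplier_add)
qed

lemma multiplier_partial_quintic: "multiplier 4 (partial i quintic)"
proof -
  note p = multiplier_power_sum and x = multiplier_coord[of i]
  note m = multiplier_mult[OF p p] multiplier_mult[OF p multiplier_power[OF p]]
    multiplier_power[OF p] p multiplier_power[OF x]
    multiplier_mult[OF p multiplier_power[OF x]] multiplier_mult[OF multiplier_mult[OF p p] x]
    multiplier_mult[OF p x] multiplier_mult[OF multiplier_power[OF p] x]
    multiplier_mult[OF multiplier_power[OF p] multiplier_power[OF x]]
  have eq: "partial i quintic = (\<lambda>v. 1 / 3 * (384 * v $ i ^ 4 - 192 * (power_sum 1 v * v $ i ^ 3)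
    + 48 * (power_sum 1 v ^ 2 * v $ i ^ 2) - 96 * (power_sum 2 v * v $ i ^ 2)
    + 48 * (power_sum 1 v * power_sum 2 v * v $ i) - 64 * (power_sum 3 v * v $ i)
    - 8 * (power_sum 1 v ^ 3 * v $ i) - 48 * power_sum 4 v + 32 * (power_sum 3 v * power_sum 1 v)
    + 12 * power_sum 2 v ^ 2 - 12 * (power_sum 2 v * power_sum 1 v ^ 2) + power_sum 1 v ^ 4))"
    unfolding partial_quintic[abs_def] critical_cubic_def igusa_form_def
    by (rule ext) (simp add: field_simps eval_nat_numeral)
  show ?thesis
    unfolding eq
    by (intro multiplier_add multiplier_diff multiplier_cmult; rule multiplier_cong, rule m, simp)
qed

section \<open>Counting forms in the partial derivatives\<close>

lemma sum_fun_apply: "(\<Sum>i\<in>I. f i) x = (\<Sum>i\<in>I. f i x :: complex)"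
  by (induction I rule: infinite_finite_induct) simp_all

text \<open>Formulated for families, since the coefficients have to be attached to indices. A
  repeated member gives a relation with coefficients 1 and -1; otherwise there are too many distinct
  vectors for the span.\<close>

lemma linear_relation:
  fixes g :: "'i \<Rightarrow> 'a \<Rightarrow> complex"
  assumes "finite T" "finite I" "card T < card I" "\<And>i. i \<in> I \<Longrightarrow> g i \<in> fun_space.span T"
  shows "\<exists>c. (\<exists>i\<in>I. c i \<noteq> 0) \<and> (\<forall>x. (\<Sum>i\<in>I. c i * g i x) = 0)"
proof (cases "inj_on g I")
  case True
  then have "card (g ` I) = card I"
    by (rule card_image)
  moreover have sub: "g ` I \<subseteq> fun_space.span T"
    using assms(4) by (rule image_subsetI)
  ultimately have "\<not> fun_space.independent (g ` I)"
    using fun_space.independent_span_bound[OF assms(1) _ sub] assms(3) by linarith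
  then have "\<exists>u. (\<exists>v\<in>g ` I. u v \<noteq> 0) \<and> (\<Sum>v\<in>g ` I. (\<lambda>x. u v * v x)) = 0"
    unfolding not_not by (rule fun_space.dependent_finite[THEN iffD1, rotated]) (simp add: assms(2))
  then obtain u where u: "\<exists>v\<in>g ` I. u v \<noteq> 0" "(\<Sum>v\<in>g ` I. (\<lambda>x. u v * v x)) = 0"
    by blast
  have "(\<Sum>i\<in>I. u (g i) * g i x) = 0" for x
  proof -
    have "(\<Sum>i\<in>I. u (g i) * g i x) = (\<Sum>v\<in>g ` I. (\<lambda>x. u v * v x)) x"
      by (simp add: sum.reindex[OF True] sum_fun_apply)
    then show ?thesis
      by (simp add: u(2))
  qed
  with u(1) show ?thesis
    by (intro exI[of _ "\<lambda>i. u (g i)"]) auto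
next
  case False
  then obtain i j where ij: "i \<in> I" "j \<in> I" "i \<noteq> j" "g i = g j"
    by (auto simp: inj_on_def)
  define c :: "'i \<Rightarrow> complex" where "c k = (if k = i then 1 else 0) - (if k = j then 1 else 0)" for k
  have "(\<Sum>k\<in>I. c k * g k x) = g i x - g j x" for x
    using ij assms(2) by (simp add: c_def left_diff_distrib sum_subtractf if_distrib[of "\<lambda>y. y * _"]
        cong: if_cong)
  moreover have "c i \<noteq> 0"
    using ij by (simp add: c_def)
  ultimately show ?thesis
    using ij by (intro exI[of _ c]) auto
qed

text \<open>Kronecker substitution: the monomials are indexed by the base-\<open>B\<close> digits of a number, and
  the point \<open>(t, t^B, t^(B^2), t^(B^3), 1)\<close> separates them.\<close>

definition digit_monomial :: "nat \<Rightarrow> nat \<Rightarrow> complex ^ 5 \<Rightarrow> complex" where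
  "digit_monomial B n a = (let d1 = n mod B; d2 = n div B mod B; d3 = n div B div B mod B;
    d4 = n div B div B div B
    in a $ 1 ^ d1 * a $ 2 ^ d2 * a $ 3 ^ d3 * a $ 4 ^ d4 * a $ 5 ^ (4 * B - d1 - d2 - d3 - d4))"

text \<open>Makes the truncated subtraction in the last exponent of \<open>digit_monomial\<close>
  exact, so that its total degree is \<open>4 * B\<close>.\<close>

lemma digits_le:
  fixes n B :: nat
  assumes "n < B ^ 4"
  shows "n mod B + n div B mod B + n div B div B mod B + n div B div B div B \<le> 4 * B"
proof -
  have "B > 0"
    using assms by (cases B) auto
  moreover have "n div B div B div B < B"
    using assms by (simp add: div_mult2_eq[symmetric] less_mult_imp_div_less eval_nat_numeral mult.assoc)
  ultimately show ?thesis
    using mod_less_divisor[of B n] mod_less_divisor[of B "n div B"] mod_less_divisor[of B "n div B div B"]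
    by linarith
qed

lemma form_cong: "form d g \<Longrightarrow> d = e \<Longrightarrow> form e g"
  by simp

lemma form_digit_monomial: "n < B ^ 4 \<Longrightarrow> form (4 * B) (digit_monomial B n)"
proof -
  assume "n < B ^ 4"
  note d = digits_le[OF this]
  have x: "form k (\<lambda>a. a $ i ^ k)" for i :: 5 and k
    using form_power[OF form_coord, of k] by simp
  show ?thesis
    unfolding digit_monomial_def[abs_def] Let_def
    by (rule form_cong[OF form_mult[OF form_mult[OF form_mult[OF form_mult[OF x x] x] x] x]])
      (use d in simp)
qed

lemma digit_monomial_gradient:
  assumes "n < B ^ 4"
  shows "on_threefold (\<lambda>v. digit_monomial B n (gradient quintic v)) \<in> threefold_forms (16 * B)"
proof -
  note d = digits_le[OF assms]
  have x: "multiplier (4 * k) (\<lambda>v. gradient quintic v $ i ^ k)" for i k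
    using multiplier_power[OF multiplier_partial_quintic] by (simp add: gradient_def)
  have "multiplier (16 * B) (\<lambda>v. digit_monomial B n (gradient quintic v))"
    unfolding digit_monomial_def Let_def
    by (rule multiplier_cong[OF multiplier_mult[OF multiplier_mult[OF multiplier_mult[OF multiplier_mult[OF x x] x] x] x]])
      (use d in simp)
  moreover have "on_threefold (\<lambda>v. 1) \<in> threefold_forms 0"
    using threefold_forms_monomial[of 0 0 0 0 0 0] by simp
  ultimately have "(\<lambda>v. digit_monomial B n (gradient quintic v) * on_threefold (\<lambda>v. 1) v) \<in> threefold_forms (16 * B)"
    by (rule multiplier_apply) simp
  moreover have "(\<lambda>v. digit_monomial B n (gradient quintic v) * on_threefold (\<lambda>v. 1) v) =
      on_threefold (\<lambda>v. digit_monomial B n (gradient quintic v))"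
    by (auto simp: on_threefold_def)
  ultimately show ?thesis
    by simp
qed

lemma digit_monomial_kronecker:
  assumes "a $ 1 = t" "a $ 2 = t ^ B" "a $ 3 = t ^ (B * B)" "a $ 4 = t ^ (B * B * B)" "a $ 5 = 1"
  shows "digit_monomial B n a = t ^ n"
proof -
  have "n mod B + B * (n div B mod B) + B * B * (n div B div B mod B) + B * B * B * (n div B div B div B)
    = n mod B + B * (n div B mod B + B * (n div B div B mod B + B * (n div B div B div B)))"
    by (simp only: distrib_left mult.assoc add.assoc)
  also have "\<dots> = n"
    by (simp only: mod_mult_div_eq)
  finally have n: "t ^ n = t ^ (n mod B + B * (n div B mod B) + B * B * (n div B div B mod B)
    + B * B * B * (n div B div B div B))"
    by (simp only:)
  show ?thesis
    unfolding n digit_monomial_def Let_def assms by (simp only: power_mult power_add power_one mult_1_right)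
qed

text \<open>\<open>B ^ 4\<close> monomials in the partial derivatives lie in a space of dimension at
  most \<open>5 * (16 * B + 1) ^ 3\<close>; a linear relation between them is \<open>G\<close>. The
  witness has positive coordinates so that the sums of coordinates used later are nonzero at the
  same point.\<close>

lemma dual_form:
  obtains N G where "form N G" "\<And>v. quintic v = 0 \<Longrightarrow> G (gradient quintic v) = 0"
    and "\<exists>a. G a \<noteq> 0 \<and> (\<forall>i. \<exists>r>0. a $ i = complex_of_real r)"
proof -
  \<comment> \<open>The left side grows like 20480 times \<open>B ^ 3\<close>, so \<open>B\<close>
    must be somewhat larger than 20480.\<close>
  obtain B :: nat where B: "5 * (16 * B + 1) ^ 3 < B ^ 4"
    by (rule that[of 30000]) simp
  have "card (reduced_monomials (16 * B)) < card {..<B ^ 4}"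
    using card_reduced_monomials(2)[of "16 * B"] B by simp
  then have "\<exists>c. (\<exists>n\<in>{..<B ^ 4}. c n \<noteq> 0) \<and>
      (\<forall>v. (\<Sum>n<B ^ 4. c n * on_threefold (\<lambda>v. digit_monomial B n (gradient quintic v)) v) = 0)"
    using digit_monomial_gradient[of _ B] unfolding threefold_forms_def
    by (intro linear_relation[OF card_reduced_monomials(1)]) auto
  then obtain c n0 where n0: "n0 < B ^ 4" "c n0 \<noteq> 0"
    and c: "\<And>v. (\<Sum>n<B ^ 4. c n * on_threefold (\<lambda>v. digit_monomial B n (gradient quintic v)) v) = 0"
    by blast
  define G where "G a = (\<Sum>n<B ^ 4. c n * digit_monomial B n a)" for a
  have "form (4 * B) G"
    unfolding G_def[abs_def] by (intro form_sum form_cmult form_digit_monomial) simp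
  moreover have "G (gradient quintic v) = 0" if "quintic v = 0" for v
    using c[of v] that by (simp add: G_def on_threefold_def)
  moreover have "\<exists>a. G a \<noteq> 0 \<and> (\<forall>i. \<exists>r>0. a $ i = complex_of_real r)"
  proof -
    \<comment> \<open>The restriction of \<open>G\<close> to the Kronecker curve. It has the same
      coefficients as the relation, so it is a nonzero polynomial with finitely many roots and some
      positive real number is not one of them.\<close>
    define p where "p = (\<Sum>n<B ^ 4. monom (c n) n)"
    have "coeff p n0 = c n0"
      using n0(1) by (simp add: p_def coeff_sum)
    then have "p \<noteq> 0"
      using n0(2) by auto
    then have "finite {z. poly p z = 0}"
      by (rule poly_roots_finite)
    moreover have "infinite (complex_of_real ` {0<..})"
      by (subst finite_image_iff) (auto simp: infinite_Ioi inj_on_def)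
    ultimately have "\<not> complex_of_real ` {0<..} \<subseteq> {z. poly p z = 0}"
      using finite_subset by blast
    then obtain r where r: "r > 0" "poly p (complex_of_real r) \<noteq> 0"
      by auto
    define b where "b i = (if i = (1 :: 5) then r else if i = 2 then r ^ B else if i = 3 then r ^ (B * B)
      else if i = 4 then r ^ (B * B * B) else 1)" for i
    define a where "a = (\<chi> i. complex_of_real (b i))"
    have "G a = poly p (complex_of_real r)"
      unfolding G_def p_def poly_sum
      by (intro sum.cong) (simp_all add: poly_monom digit_monomial_kronecker[where t = "complex_of_real r"] a_def b_def)
    moreover have "\<forall>i. b i > 0"
      using r(1) by (simp add: b_def)
    ultimately show ?thesis
      using r(2) by (intro exI[of _ a]) (auto simp: a_def)
  qed
  ultimately show thesis
    by (rule that)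
qed

section \<open>The singular lines of the Igusa quartic\<close>

lemma subspace_hyperplane: "vec.subspace (hyperplane a)"
  unfolding vec.subspace_def hyperplane_def
  by (auto simp: distrib_left sum.distrib sum_distrib_left[symmetric] mult.left_commute)

text \<open>A coordinate vector off the hyperplane completes it to the whole space.\<close>

lemma dim_hyperplane:
  fixes a :: "complex ^ 'n"
  assumes "a \<noteq> 0"
  shows "Suc (vec.dim (hyperplane a)) = CARD('n)"
proof -
  obtain i where i: "a $ i \<noteq> 0"
    using assms by (auto simp: vec_eq_iff)
  have a: "(\<Sum>j\<in>UNIV. a $ j * axis i c $ j) = a $ i * c" for c
    by (simp add: axis_def if_distrib cong: if_cong)
  have "axis i 1 \<notin> vec.span (hyperplane a)"
    unfolding vec.span_eq_iff[THEN iffD2, OF subspace_hyperplane] using i a[of 1] by (simp add: hyperplane_def)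
  then have "vec.dim (insert (axis i 1) (hyperplane a)) = Suc (vec.dim (hyperplane a))"
    by (simp add: vec.dim_insert)
  moreover have "vec.span (insert (axis i 1) (hyperplane a)) = UNIV"
  proof (intro equalityI subsetI UNIV_I)
    fix v :: "complex ^ 'n"
    define k where "k = (\<Sum>j\<in>UNIV. a $ j * v $ j) / a $ i"
    have "(\<Sum>j\<in>UNIV. a $ j * (v - k *s axis i 1) $ j) = (\<Sum>j\<in>UNIV. a $ j * v $ j) - k * (a $ i * 1)"
      unfolding a[symmetric] by (simp add: right_diff_distrib sum_subtractf sum_distrib_left mult_ac)
    then have "v - k *s axis i 1 \<in> hyperplane a"
      using i by (simp add: hyperplane_def k_def)
    then have "k *s axis i 1 + (v - k *s axis i 1) \<in> vec.span (insert (axis i 1) (hyperplane a))"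
      by (intro vec.span_add vec.span_scale vec.span_base) auto
    then show "v \<in> vec.span (insert (axis i 1) (hyperplane a))"
      by simp
  qed
  ultimately show ?thesis
    by (metis vec.dim_span vec_dim_card)
qed

section \<open>The Segre cubic and its gradient map\<close>

lemma segre_cubic_power_sums: "segre_cubic v = power_sum 3 v - (power_sum 1 v) ^ 3"
  unfolding segre_cubic_def power_sum_def Let_def sum_UNIV_5 power_one_right by algebra

lemma gradient_segre_cubic:
  "gradient segre_cubic v $ i = 3 * ((v $ i)\<^sup>2 - (power_sum 1 v)\<^sup>2)"
proof -
  note [derivative_intros] = has_derivative_power_sum
  have "(segre_cubic has_derivative (\<lambda>u. \<Sum>i\<in>UNIV. 3 * ((v $ i)\<^sup>2 - (power_sum 1 v)\<^sup>2) * u $ i)) (at v)"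
    unfolding segre_cubic_power_sums[abs_def]
    by (rule has_derivative_eq_rhs, (rule derivative_intros)+)
      (simp add: fun_eq_iff sum_UNIV_5, rule allI, algebra)
  then show ?thesis
    unfolding gradient_def vec_lambda_beta by (rule partial_eqI)
qed

text \<open>Composed with the gradient map, the quartic has degree 8 and is divisible by the Segre
  cubic, with an explicit cofactor of degree 5; the factor 15 clears its denominators.\<close>

lemma igusa_form_gradient:
  assumes "segre_cubic v = 0"
  shows "igusa_form (gradient segre_cubic v) = 0"
proof -
  define p where "p k = power_sum k v" for k
  define y where "y i = (v $ i)\<^sup>2 - (p 1)\<^sup>2" for i
  define S where "S k = (\<Sum>i\<in>UNIV. y i ^ k)" for k
  have P: "power_sum k (gradient segre_cubic v) = 3 ^ k * S k" for k
    unfolding power_sum_def gradient_segre_cubic y_def p_def S_def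
    by (simp only: power_mult_distrib sum_distrib_left)
  have "15 * (48 * S 4 - 32 * S 3 * S 1 - 12 * (S 2)\<^sup>2 + 12 * S 2 * (S 1)\<^sup>2 - (S 1) ^ 4)
    = 16 * (24 * p 5 - 10 * p 3 * p 2 - 10 * p 3 * (p 1)\<^sup>2 + 10 * p 2 * (p 1) ^ 3 - 14 * (p 1) ^ 5)
      * (p 3 - (p 1) ^ 3)"
    unfolding S_def y_def p_def power_sum_def sum_UNIV_5 power_one_right by algebra
  moreover have "p 3 - (p 1) ^ 3 = 0"
    using assms by (simp add: segre_cubic_power_sums p_def)
  ultimately have "15 * igusa_form (gradient segre_cubic v) = 0"
    unfolding igusa_form_def P by algebra
  then show ?thesis by simp
qed

text \<open>At a point \<open>(A, -A, B, -B, 0)\<close> the first and third power sums vanish, so it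
  lies on the cubic and its gradient consists of 3 times the squared coordinates. Square roots give
  the preimage.\<close>

lemma pairing_line_subset_gradient:
  assumes "distinct [a, b, c, d, e]" "v \<in> pairing_line a b c d e"
  shows "\<exists>w. segre_cubic w = 0 \<and> gradient segre_cubic w = v"
proof -
  define A B where "A = csqrt (v $ a / 3)" and "B = csqrt (v $ c / 3)"
  define w :: "complex ^ 5" where
    "w = (\<chi> i. if i = a then A else if i = b then - A else if i = c then B else if i = d then - B else 0)"
  have w: "w $ a = A" "w $ b = - A" "w $ c = B" "w $ d = - B" "w $ e = 0"
    using assms(1) by (auto simp: w_def)
  have p: "power_sum k w = A ^ k + (- A) ^ k + B ^ k + (- B) ^ k + 0 ^ k" for k
    using power_sum_distinct[OF assms(1), of k w] by (simp add: w)
  have "gradient segre_cubic w = v"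
    using assms(2) by (intro vec_5_eqI[OF assms(1)])
      (simp_all add: gradient_segre_cubic w p A_def B_def pairing_line_def)
  moreover have "segre_cubic w = 0"
    by (simp add: segre_cubic_power_sums p power3_eq_cube)
  ultimately show ?thesis by blast
qed

lemma gradient_in_igusa_quartic:
  "segre_cubic w = 0 \<Longrightarrow> gradient segre_cubic w \<noteq> 0 \<Longrightarrow> gradient segre_cubic w \<in> igusa_quartic"
  unfolding igusa_quartic_def zariski_closure_def vanishing_forms_def by blast

lemma vanishing_forms_igusa_quartic:
  "g \<in> vanishing_forms igusa_quartic \<longleftrightarrow>
    (\<exists>d. form d g) \<and> (\<forall>w. segre_cubic w = 0 \<longrightarrow> g (gradient segre_cubic w) = 0)"
proof (intro iffI conjI allI impI)
  assume g: "g \<in> vanishing_forms igusa_quartic"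
  then obtain d where d: "form d g"
    by (auto simp: vanishing_forms_def)
  then show "\<exists>d. form d g" ..
  have nz: "g (gradient segre_cubic w) = 0" if "segre_cubic w = 0" "gradient segre_cubic w \<noteq> 0" for w
    using g gradient_in_igusa_quartic[OF that] by (simp add: vanishing_forms_def)
  have "distinct [1, 2, 3, 4, 5 :: 5]"
    by simp
  moreover have "axis 1 1 + axis 2 1 \<in> pairing_line 1 2 3 4 (5 :: 5)"
    by (simp add: pairing_line_def axis_def)
  ultimately obtain w where "segre_cubic w = 0" "gradient segre_cubic w = axis 1 1 + axis 2 1"
    using pairing_line_subset_gradient by blast
  moreover have "(axis 1 1 + axis 2 1 :: complex ^ 5) $ 1 \<noteq> 0"
    by (simp add: axis_def)
  ultimately have "g (axis 1 1 + axis 2 1) = 0"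
    using nz[of w] by (metis zero_index)
  \<comment> \<open>Scaling a nonzero zero of \<open>g\<close> by 0 covers degree 0 as well, where
    \<open>g\<close> is constant.\<close>
  then have "g 0 = 0"
    using d unfolding form_def by (metis mult_zero_right vec.scale_zero_left)
  then show "g (gradient segre_cubic w) = 0" if "segre_cubic w = 0" for w
    using nz[OF that] by (cases "gradient segre_cubic w = 0") simp_all
next
  assume "(\<exists>d. form d g) \<and> (\<forall>w. segre_cubic w = 0 \<longrightarrow> g (gradient segre_cubic w) = 0)"
  then have "g \<in> vanishing_forms {gradient segre_cubic v |v. segre_cubic v = 0 \<and> gradient segre_cubic v \<noteq> 0}"
    unfolding vanishing_forms_def by blast
  moreover from this obtain d where "form d g"
    by (auto simp: vanishing_forms_def)
  ultimately show "g \<in> vanishing_forms igusa_quartic"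
    unfolding igusa_quartic_def zariski_closure_def vanishing_forms_def[of "{v. _ v}"] by blast
qed

lemma igusa_form_vanishing: "igusa_form \<in> vanishing_forms igusa_quartic"
  unfolding vanishing_forms_igusa_quartic using form_igusa_form igusa_form_gradient by blast

lemma pairing_line_subset_igusa_quartic:
  assumes "distinct [a, b, c, d, e]"
  shows "pairing_line a b c d e \<subseteq> igusa_quartic"
proof
  fix v assume "v \<in> pairing_line a b c d e"
  then obtain w where "segre_cubic w = 0" "gradient segre_cubic w = v"
    using pairing_line_subset_gradient[OF assms] by blast
  then have "g v = 0" if "g \<in> vanishing_forms igusa_quartic" for g
    using that unfolding vanishing_forms_igusa_quartic by blast
  then have "g v = 0" if "g \<in> vanishing_forms {gradient segre_cubic v |v. segre_cubic v = 0 \<and> gradient segre_cubic v \<noteq> 0}" for g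
  proof -
    have "g \<in> vanishing_forms igusa_quartic"
      using that unfolding igusa_quartic_def zariski_closure_def vanishing_forms_def[of "{v. _ v}"]
      by (auto simp: vanishing_forms_def)
    then show ?thesis
      using \<open>\<And>g. g \<in> vanishing_forms igusa_quartic \<Longrightarrow> g v = 0\<close> by blast
  qed
  then show "v \<in> igusa_quartic"
    unfolding igusa_quartic_def zariski_closure_def by blast
qed

text \<open>In the six coordinates of sum zero the curve moves the pairs \<open>(A, -A), (B, -B), (C, -C)\<close> by
  multiples of \<open>(-u, s, u - s)\<close>, the direction with \<open>\<Sum> d\<^sub>i = 0\<close> and \<open>A\<^sup>2 d\<^sub>1 + B\<^sup>2 d\<^sub>2 + C\<^sup>2 d\<^sub>3 = 0\<close>;
  varying \<open>A\<close> keeps it on the Segre cubic. The numbers \<open>A\<close>, \<open>B\<close>, \<open>C\<close> may be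
  replaced by their negatives without changing the image of the base point under the gradient map.\<close>

lemma segre_curve_tangent:
  assumes dist: "distinct [a, b, c, d, e]"
    and A: "A\<^sup>2 = C\<^sup>2 + s / 3" "A \<noteq> 0" and B: "B\<^sup>2 = C\<^sup>2 + u / 3"
    and v: "v $ a = s" "v $ b = s" "v $ c = u" "v $ d = u" "v $ e = 0"
    and g: "g \<in> vanishing_forms igusa_quartic"
  shows "A * u * (partial b g v - partial a g v) + B * s * (partial c g v - partial d g v)
    + C * (u - s) * (partial a g v + partial b g v + partial c g v + partial d g v + 2 * partial e g v) = 0"
proof -
  \<comment> \<open>Chosen so that the square of \<open>A' \<tau>\<close> drops by exactly the
    \<tau>-quadratic term that keeps the curve on the cubic. As only the square of \<tau> enters,
    \<open>A'\<close> has derivative 0 at 0.\<close>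
  define k where "k = s * (u - s) / A\<^sup>2"
  define A' where "A' \<tau> = A * csqrt (1 - \<tau>\<^sup>2 * k)" for \<tau>
  have A': "(A' \<tau>)\<^sup>2 = A\<^sup>2 - \<tau>\<^sup>2 * s * (u - s)" for \<tau>
    using A(2) by (simp add: A'_def power_mult_distrib k_def field_simps)
  have "(A' has_field_derivative 0) (at 0)"
    unfolding A'_def by (auto intro!: derivative_eq_intros simp: complex_nonpos_Reals_iff)
  then have dA': "(A' has_derivative (\<lambda>h. 0)) (at 0)"
    by (rule has_derivative_eq_rhs[OF has_field_derivative_imp_has_derivative]) (simp add: fun_eq_iff)
  have [simp]: "A' 0 = A"
    by (simp add: A'_def)
  define w :: "complex \<Rightarrow> complex ^ 5" where
    "w \<tau> = (\<chi> i. if i = a then A' \<tau> - \<tau> * u else if i = b then - A' \<tau> - \<tau> * u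
      else if i = c then B + \<tau> * s else if i = d then - B + \<tau> * s else C + \<tau> * (u - s))" for \<tau>
  have w: "w \<tau> $ a = A' \<tau> - \<tau> * u" "w \<tau> $ b = - A' \<tau> - \<tau> * u" "w \<tau> $ c = B + \<tau> * s"
    "w \<tau> $ d = - B + \<tau> * s" "w \<tau> $ e = C + \<tau> * (u - s)" for \<tau>
    using dist by (auto simp: w_def)
  have p1: "power_sum 1 (w \<tau>) = C - \<tau> * (u - s)" for \<tau>
    using power_sum_distinct[OF dist, of 1 "w \<tau>"] by (simp add: w algebra_simps)
  have segre: "segre_cubic (w \<tau>) = 0" for \<tau>
    unfolding segre_cubic_power_sums p1 power_sum_distinct[OF dist, of 3 "w \<tau>"] w
    using A'[of \<tau>] A(1) B by algebra
  define y where "y \<tau> = gradient segre_cubic (w \<tau>)" for \<tau>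
  have y: "y \<tau> $ i = 3 * ((w \<tau> $ i)\<^sup>2 - (C - \<tau> * (u - s))\<^sup>2)" for \<tau> i
    unfolding y_def gradient_segre_cubic p1 ..
  have y0: "y 0 = v"
    by (rule vec_5_eqI[OF dist]) (simp_all add: y w v A(1) B)
  \<comment> \<open>The velocity of \<open>y\<close> at 0: six times the product of the coordinate
    of \<open>w\<close> and its velocity, plus \<open>6 * C * (u - s)\<close> from the first power
    sum.\<close>
  define T where "T i = (if i = a then - 6 * A * u + 6 * C * (u - s) else if i = b then 6 * A * u + 6 * C * (u - s)
    else if i = c then 6 * B * s + 6 * C * (u - s) else if i = d then - 6 * B * s + 6 * C * (u - s)
    else 12 * C * (u - s))" for i
  have T: "T a = - 6 * A * u + 6 * C * (u - s)" "T b = 6 * A * u + 6 * C * (u - s)"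
    "T c = 6 * B * s + 6 * C * (u - s)" "T d = - 6 * B * s + 6 * C * (u - s)" "T e = 12 * C * (u - s)"
    using dist by (auto simp: T_def)
  have "(y has_derivative (\<lambda>h. \<chi> i. T i * h)) (at 0)"
  proof (rule has_derivative_vecI)
    fix i
    note [derivative_intros] = dA'
    have "i \<in> {a, b, c, d, e}"
      using UNIV_5_distinct[OF dist] by blast
    then consider "i = a" | "i = b" | "i = c" | "i = d" | "i = e"
      by blast
    then show "((\<lambda>\<tau>. y \<tau> $ i) has_derivative (\<lambda>h. (\<chi> i. T i * h) $ i)) (at 0)"
      unfolding y vec_lambda_beta
      by cases (simp only: w T, rule has_derivative_eq_rhs, (rule derivative_intros)+,
          simp add: fun_eq_iff algebra_simps)+
  qed
  moreover have "polynomial_fun g"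
    using g by (auto simp: vanishing_forms_def form_def)
  then have "(g has_derivative (\<lambda>u. \<Sum>i\<in>UNIV. partial i g v * u $ i)) (at (y 0))"
    unfolding y0 by (rule polynomial_fun_has_derivative)
  ultimately have "((\<lambda>\<tau>. g (y \<tau>)) has_derivative (\<lambda>h. \<Sum>i\<in>UNIV. partial i g v * (\<chi> i. T i * h) $ i)) (at 0)"
    by (rule has_derivative_compose)
  moreover have "g (y \<tau>) = 0" for \<tau>
    using g segre unfolding vanishing_forms_igusa_quartic y_def by blast
  ultimately have "((\<lambda>\<tau>. 0) has_derivative (\<lambda>h. \<Sum>i\<in>UNIV. partial i g v * (\<chi> i. T i * h) $ i)) (at 0)"
    by simp
  then have "(\<lambda>h. \<Sum>i\<in>UNIV. partial i g v * (\<chi> i. T i * h) $ i) = (\<lambda>h. 0)"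
    by (rule has_derivative_unique) (rule has_derivative_const)
  from fun_cong[OF this, of 1] have "(\<Sum>i\<in>UNIV. partial i g v * (\<chi> i. T i * 1) $ i) = 0" .
  then have "(\<Sum>i\<in>UNIV. partial i g v * T i) = 0"
    by simp
  then have "6 * (A * u * (partial b g v - partial a g v) + B * s * (partial c g v - partial d g v)
    + C * (u - s) * (partial a g v + partial b g v + partial c g v + partial d g v + 2 * partial e g v)) = 0"
    unfolding sum_UNIV_5_distinct[OF dist] T by algebra
  then show ?thesis
    by (rule mult_left_cancel[of 6 _ 0, THEN iffD1, unfolded mult_zero_right, rotated]) simp
qed

text \<open>Derivatives along the line make the partials opposite within each pair. The curves, with
  the signs of \<open>A\<close> and \<open>B\<close> varied, make them equal within each pair and
  then give the partial at \<open>e\<close>.\<close>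

lemma critical_on_pairing_line_generic:
  assumes dist: "distinct [a, b, c, d, e]"
    and v: "v $ a = s" "v $ b = s" "v $ c = u" "v $ d = u" "v $ e = 0"
    and nz: "s \<noteq> 0" "u \<noteq> 0" "u \<noteq> s"
    and g: "g \<in> vanishing_forms igusa_quartic"
  shows "partial i g v = 0"
proof -
  have poly: "polynomial_fun g"
    using g by (auto simp: vanishing_forms_def form_def)
  have along: "(\<Sum>i\<in>UNIV. partial i g v * x $ i) = 0" if x: "x \<in> pairing_line a b c d e" for x
  proof -
    have "((\<lambda>\<tau>. v + \<tau> *s x) has_derivative (\<lambda>h. h *s x)) (at 0)"
      by (rule has_derivative_vecI) (auto intro!: derivative_eq_intros)
    moreover have "(g has_derivative (\<lambda>h. \<Sum>i\<in>UNIV. partial i g v * h $ i)) (at (v + 0 *s x))"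
      using polynomial_fun_has_derivative[OF poly] by simp
    ultimately have "((\<lambda>\<tau>. g (v + \<tau> *s x)) has_derivative (\<lambda>h. \<Sum>i\<in>UNIV. partial i g v * (h *s x) $ i)) (at 0)"
      by (rule has_derivative_compose)
    moreover have "g (v + \<tau> *s x) = 0" for \<tau>
    proof -
      have "v + \<tau> *s x \<in> pairing_line a b c d e"
        using v x by (simp add: pairing_line_def)
      then show ?thesis
        using pairing_line_subset_gradient[OF dist] g unfolding vanishing_forms_igusa_quartic by metis
    qed
    ultimately have "((\<lambda>\<tau>. 0) has_derivative (\<lambda>h. \<Sum>i\<in>UNIV. partial i g v * (h *s x) $ i)) (at 0)"
      by simp
    then have "(\<lambda>h. \<Sum>i\<in>UNIV. partial i g v * (h *s x) $ i) = (\<lambda>h. 0)"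
      by (rule has_derivative_unique) (rule has_derivative_const)
    from fun_cong[OF this, of 1] have "(\<Sum>i\<in>UNIV. partial i g v * (1 *s x) $ i) = 0" .
    then show ?thesis by simp
  qed
  have ab: "partial a g v + partial b g v = 0"
    using along[of "axis a 1 + axis b 1"] dist
    by (auto simp: sum_UNIV_5_distinct[OF dist] pairing_line_def axis_def)
  have cd: "partial c g v + partial d g v = 0"
    using along[of "axis c 1 + axis d 1"] dist
    by (auto simp: sum_UNIV_5_distinct[OF dist] pairing_line_def axis_def)
  \<comment> \<open>Besides 0, at most two values of the square of \<open>C\<close> are forbidden,
    and 1, 2, 3 have three different squares.\<close>
  have "\<exists>C :: complex. C \<noteq> 0 \<and> C\<^sup>2 + s / 3 \<noteq> 0 \<and> C\<^sup>2 + u / 3 \<noteq> 0"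
  proof (rule ccontr)
    assume "\<not> ?thesis"
    then have "C = 0 \<or> s / 3 = - C\<^sup>2 \<or> u / 3 = - C\<^sup>2" for C :: complex
      by (auto simp: add_eq_0_iff)
    from this[of 1] this[of 2] this[of 3] show False
      by auto
  qed
  then obtain C where C: "C \<noteq> 0" "C\<^sup>2 + s / 3 \<noteq> 0" "C\<^sup>2 + u / 3 \<noteq> 0"
    by blast
  define A B where "A = csqrt (C\<^sup>2 + s / 3)" and "B = csqrt (C\<^sup>2 + u / 3)"
  have A: "A\<^sup>2 = C\<^sup>2 + s / 3" "A \<noteq> 0" and B: "B\<^sup>2 = C\<^sup>2 + u / 3" "B \<noteq> 0"
    using C by (simp_all add: A_def B_def)
  have A': "(- A)\<^sup>2 = C\<^sup>2 + s / 3" "- A \<noteq> 0" and B': "(- B)\<^sup>2 = C\<^sup>2 + u / 3"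
    using A B by simp_all
  \<comment> \<open>The tangent relation is \<open>X + Y + Z = 0\<close>; replacing \<open>A\<close>
    or \<open>B\<close> by its negative flips the sign of \<open>X\<close> or \<open>Y\<close>
    alone.\<close>
  define X Y Z where "X = A * u * (partial b g v - partial a g v)"
    and "Y = B * s * (partial c g v - partial d g v)"
    and "Z = C * (u - s) * (partial a g v + partial b g v + partial c g v + partial d g v + 2 * partial e g v)"
  have "X + Y + Z = 0" "- X + Y + Z = 0" "X - Y + Z = 0"
    using segre_curve_tangent[OF dist A B(1) v g] segre_curve_tangent[OF dist A' B(1) v g]
      segre_curve_tangent[OF dist A B' v g] unfolding X_def Y_def Z_def by simp_all
  then have "X = 0" "Y = 0" "Z = 0"
    by algebra+
  then have "partial b g v = partial a g v" "partial c g v = partial d g v"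
    "partial a g v + partial b g v + partial c g v + partial d g v + 2 * partial e g v = 0"
    using A(2) B(2) C(1) nz unfolding X_def Y_def Z_def by simp_all
  with ab cd have "partial a g v = 0" "partial b g v = 0" "partial c g v = 0" "partial d g v = 0" "partial e g v = 0"
    by algebra+
  moreover have "i \<in> {a, b, c, d, e}"
    using UNIV_5_distinct[OF dist] by blast
  ultimately show ?thesis
    by blast
qed

text \<open>The special points of the line follow by continuity.\<close>

lemma critical_on_pairing_line:
  assumes dist: "distinct [a, b, c, d, e]" and v: "v \<in> pairing_line a b c d e"
    and g: "g \<in> vanishing_forms igusa_quartic"
  shows "partial i g v = 0"
proof -
  have poly: "polynomial_fun g"
    using g by (auto simp: vanishing_forms_def form_def)
  \<comment> \<open>In this direction the two values become \<open>v $ a + \<tau>\<close> and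
    \<open>v $ c + \<tau> * 2\<close>, so each of the three genericity conditions fails for one
    \<tau> only.\<close>
  define x :: "complex ^ 5" where "x = (\<chi> i. if i \<in> {a, b} then 1 else if i \<in> {c, d} then 2 else 0)"
  have x: "x $ a = 1" "x $ b = 1" "x $ c = 2" "x $ d = 2" "x $ e = 0"
    using dist by (auto simp: x_def)
  have "isCont (\<lambda>\<tau>. v + \<tau> *s x) 0"
    unfolding isCont_def by (rule vec_tendstoI) (auto intro!: tendsto_eq_intros)
  then have "isCont (\<lambda>\<tau>. partial i g (v + \<tau> *s x)) 0"
    by (rule isCont_o2)
      (use polynomial_fun_continuous[OF polynomial_fun_partial[OF poly], of UNIV] in
        \<open>simp add: continuous_on_eq_continuous_at\<close>)
  then have "((\<lambda>\<tau>. partial i g (v + \<tau> *s x)) \<longlongrightarrow> partial i g v) (at 0)"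
    unfolding isCont_def by simp
  moreover have "\<forall>\<^sub>F \<tau> in at 0. partial i g (v + \<tau> *s x) = 0"
  proof -
    have "\<forall>\<^sub>F \<tau> in at 0. \<tau> \<noteq> - v $ a \<and> \<tau> \<noteq> - v $ c / 2 \<and> \<tau> \<noteq> v $ a - v $ c"
      by (intro eventually_conj eventually_neq_at_within)
    then show ?thesis
    proof eventually_elim
      case (elim \<tau>)
      then have "v $ a + \<tau> \<noteq> 0" "v $ c + \<tau> * 2 \<noteq> 0" "v $ c + \<tau> * 2 \<noteq> v $ a + \<tau>"
        by (auto simp: add_eq_0_iff2 field_simps)
      then show ?case
        using v x by (intro critical_on_pairing_line_generic[OF dist _ _ _ _ _ _ _ _ g, of _ "v $ a + \<tau>" "v $ c + \<tau> * 2"])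
          (simp_all add: pairing_line_def)
    qed
  qed
  ultimately have "((\<lambda>\<tau>. 0) \<longlongrightarrow> partial i g v) (at (0 :: complex))"
    by (rule Lim_transform_eventually)
  then show ?thesis
    by (simp add: tendsto_const_iff)
qed

section \<open>Singular points and lines of the Igusa quartic\<close>

lemma pairing_line_singular:
  assumes "distinct [a, b, c, d, e]" "v \<in> pairing_line a b c d e" "v \<noteq> 0"
  shows "v \<in> singular_points 3 igusa_quartic"
proof -
  have T: "tangent_space igusa_quartic v = UNIV"
    using critical_on_pairing_line[OF assms(1,2)] by (simp add: tangent_space_def)
  have "vec.dim (tangent_space igusa_quartic v) = 5"
    unfolding T vec_dim_card by simp
  with assms pairing_line_subset_igusa_quartic[OF assms(1)] show ?thesis
    unfolding singular_points_def by auto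
qed

text \<open>Where the gradient of \<open>igusa_form\<close> is nonzero, the tangent space lies in a
  hyperplane of dimension 4, which is not above the bound 3 + 1.\<close>

lemma singular_points_igusa_quartic:
  assumes "v \<in> singular_points 3 igusa_quartic"
  shows "v \<in> \<Union> pairing_lines"
proof (rule critical_igusa_form, rule ccontr)
  fix i assume "partial i igusa_form v \<noteq> 0"
  then have "gradient igusa_form v \<noteq> 0"
    by (auto simp: gradient_def vec_eq_iff)
  then have "vec.dim (hyperplane (gradient igusa_form v)) = 4"
    using dim_hyperplane by fastforce
  moreover have "tangent_space igusa_quartic v \<subseteq> hyperplane (gradient igusa_form v)"
    using igusa_form_vanishing by (auto simp: tangent_space_def hyperplane_def gradient_def)
  then have "vec.dim (tangent_space igusa_quartic v) \<le> vec.dim (hyperplane (gradient igusa_form v))"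
    by (rule vec.dim_subset)
  ultimately show False
    using assms by (simp add: singular_points_def)
qed

text \<open>A two-dimensional subspace covered by finitely many two-dimensional subspaces is one of
  them.\<close>

lemma singular_lines_igusa_quartic: "singular_lines 3 igusa_quartic = pairing_lines"
proof (intro equalityI subsetI)
  fix L assume "L \<in> pairing_lines"
  then obtain a b c d e where dist: "distinct [a, b, c, d, e]" and L: "L = pairing_line a b c d e"
    unfolding pairing_lines_def by blast
  have "L - {0} \<subseteq> singular_points 3 igusa_quartic"
    unfolding L using pairing_line_singular[OF dist] by blast
  then show "L \<in> singular_lines 3 igusa_quartic"
    unfolding singular_lines_def L using subspace_pairing_line dim_pairing_line[OF dist] by blast
next
  fix L assume "L \<in> singular_lines 3 igusa_quartic"
  then have L: "vec.subspace L" "vec.dim L = 2" "L - {0} \<subseteq> \<Union> pairing_lines"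
    using singular_points_igusa_quartic by (auto simp: singular_lines_def)
  have fin: "finite pairing_lines"
    using card_pairing_lines by (intro card_ge_0_finite) simp
  have sub: "vec.subspace M" "vec.dim M = 2" if "M \<in> pairing_lines" for M
    using that subspace_pairing_line dim_pairing_line unfolding pairing_lines_def by auto
  obtain B where B: "B \<subseteq> L" "vec.independent B" "L \<subseteq> vec.span B" "card B = 2"
    using vec.basis_exists[of L] L(2) by metis
  then obtain x y where xy: "B = {x, y}" "x \<noteq> y"
    by (auto simp: card_2_iff)
  have nz: "x + of_nat n *s y \<noteq> 0" for n
  proof
    assume "x + of_nat n *s y = 0"
    then have "x = (- of_nat n) *s y"
      by (simp add: eq_neg_iff_add_eq_0)
    then have "x \<in> vec.span {y}"
      by (metis vec.span_base vec.span_scale singletonI)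
    then show False
      using B(2) xy by (simp add: vec.independent_insert)
  qed
  have in_L: "x + of_nat n *s y \<in> L" for n
    using L(1) B(1) xy by (intro vec.subspace_add vec.subspace_scale) auto
  have "\<forall>n. \<exists>M. M \<in> pairing_lines \<and> x + of_nat n *s y \<in> M"
    using in_L nz L(3) by blast
  then obtain f where f: "\<And>n. f n \<in> pairing_lines" "\<And>n. x + of_nat n *s y \<in> f n"
    by metis
  \<comment> \<open>Infinitely many points \<open>x + of_nat n *s y\<close> and finitely many lines:
    two of the points share a line, which then contains \<open>x\<close> and
    \<open>y\<close>.\<close>
  have "\<not> inj f"
    using finite_subset[OF _ fin, of "range f"] f(1) by (auto dest: finite_imageD)
  then obtain m n where mn: "m \<noteq> n" "f m = f n"
    by (auto simp: inj_def)
  define M where "M = f m"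
  have M: "M \<in> pairing_lines" "x + of_nat m *s y \<in> M" "x + of_nat n *s y \<in> M"
    using f mn unfolding M_def by metis+
  have diff: "(x + of_nat m *s y) - (x + of_nat n *s y) = (of_nat m - of_nat n) *s y"
    by (simp add: vec_eq_iff algebra_simps)
  have "(1 / (of_nat m - of_nat n)) *s ((x + of_nat m *s y) - (x + of_nat n *s y)) = y"
    unfolding diff vector_smult_assoc using mn(1) by simp
  then have y: "y \<in> M"
    using sub(1)[OF M(1)] M(2,3) by (metis vec.subspace_diff vec.subspace_scale)
  have "(x + of_nat m *s y) - of_nat m *s y = x"
    by simp
  then have x: "x \<in> M"
    using sub(1)[OF M(1)] M(2) y by (metis vec.subspace_diff vec.subspace_scale)
  have "L \<subseteq> M"
    using B(3) vec.span_minimal[of B M] sub(1)[OF M(1)] x y xy by auto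
  then have "L = M"
    using L(1,2) sub[OF M(1)] by (intro vec.subspace_dim_equal) auto
  with M show "L \<in> pairing_lines"
    by simp
qed

section \<open>Hyperplane sections\<close>

lemma quintic_on_pairing_line:
  assumes "distinct [a, b, c, d, e]" "v \<in> pairing_line a b c d e"
  shows "quintic v = 0"
  using quintic_near_pairing_line[OF assms(1), of v "v $ a" 0 "v $ c" 0 0] assms(2)
  by (simp add: pairing_line_def)

section \<open>Cusps of a section and tangency\<close>

lemma euler_quintic: "(\<Sum>i\<in>UNIV. partial i quintic v * v $ i) = 5 * quintic v"
proof -
  have "3 * (\<Sum>i\<in>UNIV. partial i quintic v * v $ i) = 15 * quintic v"
    unfolding partial_quintic sum_distrib_left quintic_power_sums
    unfolding critical_cubic_def igusa_form_def power_sum_def sum_UNIV_5 power_one_right by algebra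
  then show ?thesis
    by (rule mult_left_cancel[of 3, THEN iffD1, rotated, OF trans]) simp_all
qed

text \<open>The vectors with entry \<open>a $ i\<close> at \<open>j\<close> and
  \<open>- a $ j\<close> at \<open>i\<close> lie in the first hyperplane, and membership in the
  second is the proportionality of \<open>g\<close> and \<open>a\<close>.\<close>

lemma hyperplane_subset_imp_proportional:
  assumes "a \<noteq> 0" "hyperplane a \<subseteq> hyperplane g"
  shows "\<exists>c. g = c *s a"
proof -
  obtain i where i: "a $ i \<noteq> 0"
    using assms(1) by (auto simp: vec_eq_iff)
  have "g $ j = g $ i / a $ i * a $ j" for j
  proof -
    have lin: "(\<Sum>k\<in>UNIV. x $ k * (a $ i *s axis j 1 - a $ j *s axis i 1) $ k) = a $ i * x $ j - a $ j * x $ i"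
      for x
    proof -
      have "(\<Sum>k\<in>UNIV. x $ k * (a $ i *s axis j 1 - a $ j *s axis i 1) $ k) =
          (\<Sum>k\<in>UNIV. (if k = j then a $ i * x $ j else 0) - (if k = i then a $ j * x $ i else 0))"
        by (intro sum.cong) (auto simp: axis_def algebra_simps)
      then show ?thesis
        by (simp add: sum_subtractf)
    qed
    then have "a $ i *s axis j 1 - a $ j *s axis i 1 \<in> hyperplane a"
      unfolding hyperplane_def by simp
    then have "a $ i *s axis j 1 - a $ j *s axis i 1 \<in> hyperplane g"
      using assms(2) by blast
    then have "a $ i * g $ j = a $ j * g $ i"
      using lin[of g] unfolding hyperplane_def by simp
    then show ?thesis
      using i by (simp add: field_simps)
  qed
  then show ?thesis
    unfolding vec_eq_iff vector_smult_component by blast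
qed

text \<open>The restricted quintic is critical at a cusp, so the gradient annihilates the directions
  \<open>b i\<close>; the direction \<open>v\<close> follows from Euler's relation.\<close>

lemma section_cusp_gradient:
  fixes b :: "3 \<Rightarrow> complex ^ 5"
  assumes "A2_singularity (\<lambda>z. quintic (v + (\<Sum>i\<in>UNIV. z $ i *s b i)))"
    and H: "H = vec.span (insert v (range b))"
  shows "quintic v = 0" "H \<subseteq> hyperplane (gradient quintic v)"
proof -
  have "((\<lambda>z. v + (\<Sum>i\<in>UNIV. z $ i *s b i)) has_derivative (\<lambda>u. \<Sum>i\<in>UNIV. u $ i *s b i)) (at 0)"
    by (rule has_derivative_vecI) (auto intro!: derivative_eq_intros bounded_linear_imp_has_derivative
        bounded_linear_mult_left bounded_linear_compose[OF bounded_linear_mult_left bounded_linear_vec_nth])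
  moreover have "(quintic has_derivative (\<lambda>u. \<Sum>j\<in>UNIV. partial j quintic v * u $ j))
      (at (v + (\<Sum>i\<in>UNIV. 0 $ i *s b i)))"
    using has_derivative_quintic[folded partial_quintic] by simp
  ultimately have deriv: "((\<lambda>z. quintic (v + (\<Sum>i\<in>UNIV. z $ i *s b i))) has_derivative
      (\<lambda>u. \<Sum>j\<in>UNIV. partial j quintic v * (\<Sum>i\<in>UNIV. u $ i *s b i) $ j)) (at 0)"
    by (rule has_derivative_compose)
  show v: "quintic v = 0"
    using A2_singularity_critical(1)[OF assms(1) deriv] by simp
  have D: "(\<Sum>j\<in>UNIV. partial j quintic v * (\<Sum>i\<in>UNIV. u $ i *s b i) $ j) = 0" for u :: "complex ^ 3"
    using fun_cong[OF A2_singularity_critical(2)[OF assms(1) deriv], of u] .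
  have "b i \<in> hyperplane (gradient quintic v)" for i
  proof -
    have "(\<Sum>k\<in>UNIV. axis i 1 $ k *s b k) = (\<Sum>k\<in>UNIV. if k = i then b i else 0)"
      by (intro sum.cong) (auto simp: axis_def)
    then have "(\<Sum>k\<in>UNIV. axis i 1 $ k *s b k) = b i"
      by simp
    then show ?thesis
      using D[of "axis i 1"] by (simp add: hyperplane_def gradient_def)
  qed
  moreover have "v \<in> hyperplane (gradient quintic v)"
    using euler_quintic[of v] v by (simp add: hyperplane_def gradient_def)
  ultimately show "H \<subseteq> hyperplane (gradient quintic v)"
    unfolding H by (intro vec.span_minimal subspace_hyperplane) auto
qed

section \<open>Points of the section on the lines\<close>

definition section_point :: "complex ^ 5 \<Rightarrow> 5 \<Rightarrow> 5 \<Rightarrow> 5 \<Rightarrow> 5 \<Rightarrow> complex ^ 5" where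
  "section_point \<alpha> a b c d = (\<chi> i. if i \<in> {a, b} then \<alpha> $ c + \<alpha> $ d
    else if i \<in> {c, d} then - (\<alpha> $ a + \<alpha> $ b) else 0)"

lemma section_point_nth:
  assumes "distinct [a, b, c, d, e]"
  shows "section_point \<alpha> a b c d $ a = \<alpha> $ c + \<alpha> $ d" "section_point \<alpha> a b c d $ b = \<alpha> $ c + \<alpha> $ d"
    "section_point \<alpha> a b c d $ c = - (\<alpha> $ a + \<alpha> $ b)" "section_point \<alpha> a b c d $ d = - (\<alpha> $ a + \<alpha> $ b)"
    "section_point \<alpha> a b c d $ e = 0"
  using assms by (auto simp: section_point_def)

text \<open>On the line with values \<open>s\<close>, \<open>u\<close> the hyperplane equation is
  \<open>s * (\<alpha> $ a + \<alpha> $ b) + u * (\<alpha> $ c + \<alpha> $ d) = 0\<close>;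
  \<open>section_point\<close> is its solution written without division.\<close>

lemma pairing_line_section:
  assumes dist: "distinct [a, b, c, d, e]" and "\<alpha> $ a + \<alpha> $ b \<noteq> 0"
  shows "pairing_line a b c d e \<inter> hyperplane \<alpha> = vec.span {section_point \<alpha> a b c d}"
proof (intro equalityI subsetI)
  fix v assume v: "v \<in> pairing_line a b c d e \<inter> hyperplane \<alpha>"
  then have v: "v $ b = v $ a" "v $ d = v $ c" "v $ e = 0"
    and H: "\<alpha> $ a * v $ a + \<alpha> $ b * v $ a + \<alpha> $ c * v $ c + \<alpha> $ d * v $ c = 0"
    by (auto simp: hyperplane_def sum_UNIV_5_distinct[OF dist] pairing_line_def)
  define k where "k = - v $ c / (\<alpha> $ a + \<alpha> $ b)"
  have k: "v $ c = k * - (\<alpha> $ a + \<alpha> $ b)"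
    using assms(2) by (simp add: k_def del: minus_add_distrib)
  then have "(\<alpha> $ a + \<alpha> $ b) * v $ a = (\<alpha> $ a + \<alpha> $ b) * (k * (\<alpha> $ c + \<alpha> $ d))"
    using H by algebra
  then have "v $ a = k * (\<alpha> $ c + \<alpha> $ d)"
    unfolding mult_left_cancel[OF assms(2)] .
  with k v have "v = k *s section_point \<alpha> a b c d"
    by (intro vec_5_eqI[OF dist]) (simp_all only: vector_smult_component section_point_nth[OF dist] mult_zero_right)
  then show "v \<in> vec.span {section_point \<alpha> a b c d}"
    by (metis vec.span_base vec.span_scale singletonI)
next
  have "section_point \<alpha> a b c d \<in> pairing_line a b c d e \<inter> hyperplane \<alpha>"
    by (simp add: pairing_line_def hyperplane_def sum_UNIV_5_distinct[OF dist] section_point_nth[OF dist]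
        algebra_simps)
  then have "vec.span {section_point \<alpha> a b c d} \<subseteq> pairing_line a b c d e \<inter> hyperplane \<alpha>"
    by (intro vec.span_minimal vec.subspace_inter subspace_pairing_line subspace_hyperplane) simp
  then show "v \<in> pairing_line a b c d e \<inter> hyperplane \<alpha>" if "v \<in> vec.span {section_point \<alpha> a b c d}" for v
    using that by blast
qed

text \<open>A basis of the hyperplane is chosen in which the chart has \<open>z $ 1\<close>,
  \<open>z $ 2\<close>, \<open>z $ 3\<close> as the \<open>p\<close>, \<open>q\<close>,
  \<open>t\<close> of \<open>quintic_near_pairing_line\<close>, with \<open>u\<close> constant and
  \<open>s\<close> varying linearly.\<close>

lemma section_point_cusp:
  assumes dist: "distinct [a, b, c, d, e]"
    and nz: "\<alpha> $ a + \<alpha> $ b \<noteq> 0" "\<alpha> $ c + \<alpha> $ d \<noteq> 0" "\<alpha> $ a + \<alpha> $ b + \<alpha> $ c + \<alpha> $ d \<noteq> 0"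
  shows "vec.span {section_point \<alpha> a b c d} \<in> section_cusps quintic (hyperplane \<alpha>)"
proof -
  define s u where "s = \<alpha> $ c + \<alpha> $ d" and "u = - (\<alpha> $ a + \<alpha> $ b)"
  \<comment> \<open>The multiple of the vector with entries 1 at \<open>a\<close> and
    \<open>b\<close> that brings each basis vector into the hyperplane.\<close>
  define k where "k j = (if j = 1 then \<alpha> $ a - \<alpha> $ b else if j = 2 then \<alpha> $ c - \<alpha> $ d else \<alpha> $ e) / u"
    for j :: 3
  define p where "p = section_point \<alpha> a b c d"
  define B :: "3 \<Rightarrow> complex ^ 5" where "B j = (\<chi> i.
    if i = a then (if j = 1 then 1 else 0) + k j else if i = b then - (if j = 1 then 1 else 0) + k j
    else if i = c then (if j = 2 then 1 else 0) else if i = d then - (if j = 2 then 1 else 0)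
    else (if j = 3 then 1 else 0))" for j
  have B: "B j $ a = (if j = 1 then 1 else 0) + k j" "B j $ b = - (if j = 1 then 1 else 0) + k j"
    "B j $ c = (if j = 2 then 1 else 0)" "B j $ d = - (if j = 2 then 1 else 0)" "B j $ e = (if j = 3 then 1 else 0)"
    for j
    using dist by (auto simp: B_def)
  have p: "p $ a = s" "p $ b = s" "p $ c = u" "p $ d = u" "p $ e = 0"
    using section_point_nth[OF dist] by (simp_all add: p_def s_def u_def)
  have diff: "s - u = \<alpha> $ a + \<alpha> $ b + \<alpha> $ c + \<alpha> $ d"
    by (simp add: s_def u_def)
  have su: "s \<noteq> 0" "u \<noteq> 0" "s - u \<noteq> 0"
    unfolding diff unfolding s_def u_def neg_equal_0_iff_equal by (fact nz)+
  have ku: "k 1 * u = \<alpha> $ a - \<alpha> $ b" "k 2 * u = \<alpha> $ c - \<alpha> $ d" "k 3 * u = \<alpha> $ e"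
    using su by (simp_all add: k_def)
  have "p \<in> hyperplane \<alpha>"
    by (simp add: hyperplane_def sum_UNIV_5_distinct[OF dist] p s_def u_def algebra_simps)
  moreover have "B j \<in> hyperplane \<alpha>" for j
  proof -
    have "(\<Sum>i\<in>UNIV. \<alpha> $ i * B 1 $ i) = 0" "(\<Sum>i\<in>UNIV. \<alpha> $ i * B 2 $ i) = 0"
      "(\<Sum>i\<in>UNIV. \<alpha> $ i * B 3 $ i) = 0"
      using ku unfolding sum_UNIV_5_distinct[OF dist] B u_def by (simp_all, algebra+)
    then show ?thesis
      using exhaust_3[of j] by (auto simp: hyperplane_def)
  qed
  ultimately have "vec.span (insert p (range B)) \<subseteq> hyperplane \<alpha>"
    by (intro vec.span_minimal subspace_hyperplane) auto
  moreover have "hyperplane \<alpha> \<subseteq> vec.span (insert p (range B))"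
  proof
    fix w assume "w \<in> hyperplane \<alpha>"
    then have w: "\<alpha> $ a * w $ a + \<alpha> $ b * w $ b + \<alpha> $ c * w $ c + \<alpha> $ d * w $ d + \<alpha> $ e * w $ e = 0"
      by (simp add: hyperplane_def sum_UNIV_5_distinct[OF dist])
    \<comment> \<open>Sum and difference at \<open>c\<close>, \<open>d\<close> give the coefficients
      of \<open>p\<close> and \<open>B 2\<close>, the difference at \<open>a\<close>,
      \<open>b\<close> that of \<open>B 1\<close>; the sum at \<open>a\<close>, \<open>b\<close> is
      then forced by the hyperplane equation.\<close>
    define l z1 z2 where "l = (w $ c + w $ d) / (2 * u)" and "z1 = (w $ a - w $ b) / 2"
      and "z2 = (w $ c - w $ d) / 2"
    have l: "2 * (l * u) = w $ c + w $ d" and z: "2 * z1 = w $ a - w $ b" "2 * z2 = w $ c - w $ d"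
      using su by (simp_all add: l_def z1_def z2_def)
    have "2 * u * (l * s + (k 1 * z1 + k 2 * z2 + k 3 * w $ e)) = u * (w $ a + w $ b)"
      using l z ku w unfolding s_def u_def by algebra
    then have "u * (2 * (l * s + (k 1 * z1 + k 2 * z2 + k 3 * w $ e))) = u * (w $ a + w $ b)"
      by (simp add: mult_ac)
    then have ks: "2 * (l * s + (k 1 * z1 + k 2 * z2 + k 3 * w $ e)) = w $ a + w $ b"
      unfolding mult_left_cancel[OF su(2)] .
    have "w = l *s p + (z1 *s B 1 + (z2 *s B 2 + w $ e *s B 3))"
    proof (rule vec_5_eqI[OF dist])
      show "w $ a = (l *s p + (z1 *s B 1 + (z2 *s B 2 + w $ e *s B 3))) $ a"
        using ks z by (simp add: p B) algebra
      show "w $ b = (l *s p + (z1 *s B 1 + (z2 *s B 2 + w $ e *s B 3))) $ b"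
        using ks z by (simp add: p B) algebra
      show "w $ c = (l *s p + (z1 *s B 1 + (z2 *s B 2 + w $ e *s B 3))) $ c"
        using l z by (simp add: p B) algebra
      show "w $ d = (l *s p + (z1 *s B 1 + (z2 *s B 2 + w $ e *s B 3))) $ d"
        using l z by (simp add: p B) algebra
      show "w $ e = (l *s p + (z1 *s B 1 + (z2 *s B 2 + w $ e *s B 3))) $ e"
        by (simp add: p B)
    qed
    also have "\<dots> \<in> vec.span (insert p (range B))"
      by (intro vec.span_add vec.span_scale vec.span_base) auto
    finally show "w \<in> vec.span (insert p (range B))" .
  qed
  ultimately have H: "hyperplane \<alpha> = vec.span (insert p (range B))"
    by blast
  have "\<alpha> \<noteq> 0"
    using nz(1) by auto
  then have dim: "vec.dim (hyperplane \<alpha>) = 4"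
    using dim_hyperplane by fastforce
  define S where "S z = s + (k 1 * z $ 1 + k 2 * z $ 2 + k 3 * z $ 3)" for z :: "complex ^ 3"
  define D where "D z = 128 * S z ^ 2 * (S z - u) + 64 * S z * (u - S z) * z $ 3 + 16 * (u - S z) * z $ 3 ^ 2
    - 8 * z $ 3 ^ 3 - 64 * (S z + u) * z $ 2 ^ 2 + 32 * z $ 2 ^ 2 * z $ 3 + (96 * S z - 32 * u) * z $ 1 ^ 2
    - 16 * z $ 1 ^ 2 * z $ 3" for z
  define E where "E z = 128 * u ^ 2 * (u - S z) + 64 * u * (S z - u) * z $ 3 + 16 * (S z - u) * z $ 3 ^ 2
    - 8 * z $ 3 ^ 3 + (96 * u - 32 * S z) * z $ 2 ^ 2 - 16 * z $ 2 ^ 2 * z $ 3" for z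
  define A where "A z = 16 * S z * u - 10 * (S z + u) * z $ 3 + 7 * z $ 3 ^ 2" for z
  have S: "polynomial_fun S"
    unfolding S_def[abs_def] by (intro polynomial_fun_intros)
  have "polynomial_fun D" "polynomial_fun E" "polynomial_fun A"
    unfolding D_def[abs_def] E_def[abs_def] A_def[abs_def] by (intro polynomial_fun_intros S)+
  moreover have "D 0 \<noteq> 0" "E 0 \<noteq> 0" "A 0 \<noteq> 0"
    using su by (auto simp: D_def E_def A_def S_def)
  moreover have "quintic (p + (\<Sum>i\<in>UNIV. z $ i *s B i)) =
      (z $ 1)\<^sup>2 * D z + (z $ 2)\<^sup>2 * E z + (z $ 3) ^ 3 * A z" for z
    unfolding D_def E_def A_def
    by (rule quintic_near_pairing_line[OF dist]) (simp_all add: sum_3 p B S_def algebra_simps)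
  ultimately have "A2_singularity (\<lambda>z. quintic (p + (\<Sum>i\<in>UNIV. z $ i *s B i)))"
    by (rule A2_singularityI)
  with H dim show ?thesis
    unfolding section_cusps_def p_def[symmetric] by blast
qed

text \<open>By \<open>dual\<close> the hyperplane is tangent at no point of the threefold with
  nonzero gradient, so a cusp of the section is a critical point of the quintic and lies on a line.
  \<open>pairs\<close> and \<open>quads\<close> make the two values at each section point nonzero
  and distinct, which yields a cusp there and determines its line.\<close>

lemma quintic_section_cusps:
  assumes "\<alpha> \<noteq> 0"
    and dual: "\<And>v c. quintic v = 0 \<Longrightarrow> gradient quintic v = c *s \<alpha> \<Longrightarrow> c = 0"
    and pairs: "\<And>i j. i \<noteq> j \<Longrightarrow> \<alpha> $ i + \<alpha> $ j \<noteq> 0"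
    and quads: "\<And>i. power_sum 1 \<alpha> - \<alpha> $ i \<noteq> 0"
  shows "bij_betw (\<lambda>L. L \<inter> hyperplane \<alpha>) pairing_lines (section_cusps quintic (hyperplane \<alpha>))"
proof -
  have nz: "\<alpha> $ a + \<alpha> $ b \<noteq> 0" "\<alpha> $ c + \<alpha> $ d \<noteq> 0" "\<alpha> $ a + \<alpha> $ b + \<alpha> $ c + \<alpha> $ d \<noteq> 0"
    if "distinct [a, b, c, d, e]" for a b c d e
    using that pairs[of a b] pairs[of c d] quads[of e] power_sum_distinct[OF that, of 1 \<alpha>] by auto
  show ?thesis
  proof (rule bij_betw_imageI)
    show "inj_on (\<lambda>L. L \<inter> hyperplane \<alpha>) pairing_lines"
    proof (rule inj_onI)
      fix L L' assume L: "L \<in> pairing_lines" "L' \<in> pairing_lines" "L \<inter> hyperplane \<alpha> = L' \<inter> hyperplane \<alpha>"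
      obtain a b c d e where dist: "distinct [a, b, c, d, e]" and La: "L = pairing_line a b c d e"
        using L(1) unfolding pairing_lines_def by blast
      obtain a' b' c' d' e' where dist': "distinct [a', b', c', d', e']" and La': "L' = pairing_line a' b' c' d' e'"
        using L(2) unfolding pairing_lines_def by blast
      let ?p = "section_point \<alpha> a b c d"
      have "?p \<in> L \<inter> hyperplane \<alpha>"
        unfolding La pairing_line_section[OF dist nz(1)[OF dist]] by (rule vec.span_base) simp
      then have "?p \<in> L" "?p \<in> L'"
        using L(3) by auto
      moreover have "?p $ a \<noteq> ?p $ c"
        using nz(3)[OF dist] by (auto simp: section_point_nth[OF dist] eq_neg_iff_add_eq_0 add_ac)
      moreover have "?p $ a \<noteq> 0" "?p $ c \<noteq> 0"
        using nz(1,2)[OF dist] by (auto simp: section_point_nth[OF dist] neg_equal_0_iff_equal simp del: minus_add_distrib)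
      ultimately show "L = L'"
        using pairing_line_eqI(1)[OF dist dist'] unfolding La La' by blast
    qed
    show "(\<lambda>L. L \<inter> hyperplane \<alpha>) ` pairing_lines = section_cusps quintic (hyperplane \<alpha>)"
    proof (intro equalityI subsetI)
      fix K assume "K \<in> (\<lambda>L. L \<inter> hyperplane \<alpha>) ` pairing_lines"
      then obtain a b c d e where dist: "distinct [a, b, c, d, e]" and "K = pairing_line a b c d e \<inter> hyperplane \<alpha>"
        unfolding pairing_lines_def by blast
      then show "K \<in> section_cusps quintic (hyperplane \<alpha>)"
        using section_point_cusp[OF dist nz[OF dist]] pairing_line_section[OF dist nz(1)[OF dist]] by simp
    next
      fix K assume "K \<in> section_cusps quintic (hyperplane \<alpha>)"
      then obtain v and b :: "3 \<Rightarrow> complex ^ 5" where K: "K = vec.span {v}"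
        and dim: "vec.dim (hyperplane \<alpha>) = 4" and H: "hyperplane \<alpha> = vec.span (insert v (range b))"
        and A2: "A2_singularity (\<lambda>z. quintic (v + (\<Sum>i\<in>UNIV. z $ i *s b i)))"
        unfolding section_cusps_def by blast
      note crit = section_cusp_gradient[OF A2 H]
      obtain k where k: "gradient quintic v = k *s \<alpha>"
        using hyperplane_subset_imp_proportional[OF assms(1) crit(2)] by blast
      with dual crit(1) have "k = 0"
        by blast
      with k have "partial i quintic v = 0" for i
        by (simp add: gradient_def vec_eq_iff)
      then obtain a b' c d e where dist: "distinct [a, b', c, d, e]" and v: "v \<in> pairing_line a b' c d e"
        using critical_quintic[of v] unfolding pairing_lines_def by blast
      let ?p = "section_point \<alpha> a b' c d"
      \<comment> \<open>Otherwise the three vectors \<open>b i\<close> would span a space of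
        dimension 4.\<close>
      have "v \<noteq> 0"
      proof
        assume "v = 0"
        then have "hyperplane \<alpha> = vec.span (range b)"
          unfolding H by (simp add: vec.span_insert_0)
        then have "vec.dim (hyperplane \<alpha>) \<le> card (range b)"
          using vec.dim_le_card[of "range b" "range b"] vec.span_superset[of "range b"] by simp
        also have "\<dots> \<le> 3"
          using card_image_le[of "UNIV :: 3 set" b] by simp
        finally show False
          using dim by simp
      qed
      have "v \<in> hyperplane \<alpha>"
        unfolding H by (rule vec.span_base) simp
      with v have "v \<in> vec.span {?p}"
        unfolding pairing_line_section[OF dist nz(1)[OF dist], symmetric] by blast
      then obtain r where r: "v = r *s ?p"
        by (auto simp: vec.span_singleton)
      with \<open>v \<noteq> 0\<close> have "r \<noteq> 0"
        by auto
      with r have "?p = (1 / r) *s v"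
        by simp
      then have "?p \<in> vec.span {v}"
        by (metis vec.span_base vec.span_scale singletonI)
      with \<open>v \<in> vec.span {?p}\<close> have "vec.span {v} = vec.span {?p}"
        by (intro equalityI vec.span_minimal) (auto simp: vec.subspace_span)
      then have "K = pairing_line a b' c d e \<inter> hyperplane \<alpha>"
        unfolding K pairing_line_section[OF dist nz(1)[OF dist]] .
      moreover have "pairing_line a b' c d e \<in> pairing_lines"
        using dist unfolding pairing_lines_def by blast
      ultimately show "K \<in> (\<lambda>L. L \<inter> hyperplane \<alpha>) ` pairing_lines"
        by (rule image_eqI)
    qed
  qed
qed

theorem proposition3:
  shows "\<Union> (singular_lines 3 igusa_quartic) \<subseteq> quintic_threefold \<inter> igusa_quartic \<and>
    holds_generally (\<lambda>a.
      bij_betw (\<lambda>L. L \<inter> hyperplane a) (singular_lines 3 igusa_quartic)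
        (section_cusps quintic (hyperplane a)) \<and>
      card (section_cusps quintic (hyperplane a)) = 15)"
proof (intro conjI)
  show "\<Union> (singular_lines 3 igusa_quartic) \<subseteq> quintic_threefold \<inter> igusa_quartic"
    unfolding singular_lines_igusa_quartic pairing_lines_def quintic_threefold_def
    using quintic_on_pairing_line pairing_line_subset_igusa_quartic by blast
next
  obtain N G a0 where G: "form N G" "\<And>v. quintic v = 0 \<Longrightarrow> G (gradient quintic v) = 0"
    and a0: "G a0 \<noteq> 0" "\<forall>i. \<exists>r>0. a0 $ i = complex_of_real r"
    using dual_form by metis
  obtain r where r: "\<And>i. r i > 0" "\<And>i. a0 $ i = complex_of_real (r i)"
    using a0(2) by metis
  \<comment> \<open>The open condition is that \<open>G * P * R\<close> is nonzero: \<open>G\<close>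
    excludes tangent hyperplanes, \<open>P\<close> vanishing sums of two coordinates and
    \<open>R\<close> vanishing sums of four. All are nonzero at \<open>a0\<close>, by the choice of
    \<open>G\<close> and the positivity of its coordinates.\<close>
  define P where "P a = (\<Prod>(i, j)\<in>{(i, j). i \<noteq> j}. a $ i + a $ j)" for a :: "complex ^ 5"
  define R where "R a = (\<Prod>i\<in>UNIV. power_sum 1 a - a $ i)" for a :: "complex ^ 5"
  have "form (\<Sum>x\<in>{(i, j). (i :: 5) \<noteq> j}. 1) P"
    unfolding P_def[abs_def] by (rule form_prod) (auto intro: form_add form_coord simp del: One_nat_def)
  moreover have "form (\<Sum>i\<in>(UNIV :: 5 set). 1) R"
    unfolding R_def[abs_def] by (intro form_prod form_diff form_power_sum form_coord)
  ultimately have "\<exists>d. form d (\<lambda>a. G a * P a * R a)"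
    using form_mult[OF form_mult[OF G(1)]] by blast
  then obtain d where d: "form d (\<lambda>a. G a * P a * R a)" ..
  have "P a0 \<noteq> 0"
    unfolding P_def r(2) of_real_add[symmetric] using r(1)
    by (auto simp: add_pos_pos less_imp_neq[symmetric] simp del: of_real_add)
  moreover have "power_sum 1 a0 - a0 $ i \<noteq> 0" for i
  proof -
    have "power_sum 1 a0 - a0 $ i = complex_of_real (\<Sum>j\<in>UNIV - {i}. r j)"
      by (simp add: power_sum_def r(2) sum_diff1)
    moreover have "(\<Sum>j\<in>UNIV - {i}. r j) > 0"
    proof (rule sum_pos)
      have "card (UNIV - {i}) > 0"
        by (simp add: card_Diff_singleton)
      then show "UNIV - {i} \<noteq> {}"
        by fastforce
    qed (use r(1) in auto)
    ultimately show ?thesis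
      by (simp del: of_real_sum)
  qed
  then have "R a0 \<noteq> 0"
    by (simp add: R_def)
  ultimately have "G a0 * P a0 * R a0 \<noteq> 0"
    using a0(1) by simp
  moreover have bij: "bij_betw (\<lambda>L. L \<inter> hyperplane a) pairing_lines (section_cusps quintic (hyperplane a))"
    if a: "a \<noteq> 0" "G a * P a * R a \<noteq> 0" for a
  proof (rule quintic_section_cusps[OF a(1)])
    fix v c assume v: "quintic v = 0" "gradient quintic v = c *s a"
    \<comment> \<open>\<open>G\<close> vanishes on the gradient \<open>c *s a\<close> and is
      homogeneous of degree \<open>N\<close>; as \<open>G a\<close> is nonzero, \<open>c\<close> is
      0.\<close>
    then have "c ^ N * G a = 0"
      using G(2)[OF v(1)] G(1) unfolding form_def by simp
    then show "c = 0"
      using a(2) by simp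
  next
    fix i j :: 5 assume "i \<noteq> j"
    then have "(i, j) \<in> {(i, j). i \<noteq> j}"
      by simp
    moreover have "P a \<noteq> 0"
      using a(2) by simp
    ultimately show "a $ i + a $ j \<noteq> 0"
      unfolding P_def by auto
  next
    show "power_sum 1 a - a $ i \<noteq> 0" for i
      using a(2) by (simp add: R_def)
  qed
  ultimately show "holds_generally (\<lambda>a.
      bij_betw (\<lambda>L. L \<inter> hyperplane a) (singular_lines 3 igusa_quartic)
        (section_cusps quintic (hyperplane a)) \<and>
      card (section_cusps quintic (hyperplane a)) = 15)"
    unfolding holds_generally_def singular_lines_igusa_quartic
    using d bij bij_betw_same_card[OF bij] card_pairing_lines
    by (intro exI[of _ d] exI[of _ "\<lambda>a. G a * P a * R a"] conjI allI impI exI[of _ a0]) simp_all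
qed

end
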